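(* Let $d\ge4$, $\nu=d/2-1$. Assume: (1) there is a sequence $0=x_0<x_1<\dots<x_n<x_{n+1}=a_I$ such that for each $i\in\{1,\dots,n\}$, $f_\nu(k_\nu K(x_{i+1})x_{i+1})+K(x_i)^df_\nu(k_\nu b(x_i))\le0$, and $G_1(x_1)+G_2(x_0)\le0$; (2) there is a sequence $a_S=y_0<y_1<\dots<y_m<y_{m+1}=1$ such that for each $i\in\{0,\dots,m-1\}$, $f_\nu(k_\nu K(y_{i+1})y_{i+1})+f_\nu(k_\nu b(y_i))\le0$, and $$2T_1(y_m)-f_\nu(k_\nu b(y_m))\,|g_\nu(k_\nu K(y_m)y_m)|\left[\frac{d-1}{y_m^d}\Big(1+\frac1{b(y_m)}\Big)+1\right]-(f_\nu g_\nu)(k_\nu b(y_m))\ge0.$$ Then for every $a\in[0,a_I)\cup(a_S,1]$, $F_\nu(k_\nu,a):=f_\nu(k_\nu K(a)a)+K(a)^df_\nu(k_\nu b(a))\le0$.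
   Context: $J_\nu,I_\nu$ are the Bessel and modified Bessel functions of the first kind of order $\nu$; $j_{\nu,m}$ is the $m$-th positive zero of $J_\nu$ and $j_\nu=j_{\nu,1}$. $f_\nu(r)=r^{d-1}\big[\frac{J_{\nu+1}(r)}{J_\nu(r)}+\frac{I_{\nu+1}(r)}{I_\nu(r)}\big]$ and $g_\nu(r)=r^{1-d}\big[\frac{J_{\nu+1}(r)}{J_\nu(r)}-\frac{I_{\nu+1}(r)}{I_\nu(r)}\big]$; $k_\nu$ is the first positive zero of $f_\nu$. For $a\in[0,1]$, $b(a)\in[0,1]$ is defined by $a^d+b(a)^d=1$ and $K(a)=a^{d-1}/(1+b(a)^{d-1})$; $K'$ is its derivative. $a_I$ is defined by $b(a_I)=j_\nu/k_\nu$ and $a_S$ by $a_SK(a_S)=j_\nu/k_\nu$. $T_1(a)=(aK(a))^dK'(a)/K(a)$, $G_1(a)=[aK'(a)+K(a)](k_\nu K(a))^{d-1}g_\nu(k_\nu aK(a))$, $G_2(a)=k_\nu^{d-1}g_\nu(k_\nu b(a))$. *)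

theory Defs
  imports "HOL-Analysis.Analysis"
begin

definition besselJ :: "real \<Rightarrow> real \<Rightarrow> real" where
  "besselJ \<nu> r = (\<Sum>k. (-1)^k / (fact k * Gamma (real k + \<nu> + 1)) * (r/2) powr \<nu> * (r/2)^(2*k))"

definition besselI :: "real \<Rightarrow> real \<Rightarrow> real" where
  "besselI \<nu> r = (\<Sum>k. 1 / (fact k * Gamma (real k + \<nu> + 1)) * (r/2) powr \<nu> * (r/2)^(2*k))"

definition nu :: "nat \<Rightarrow> real" where
  "nu d = real d / 2 - 1"

definition jzero :: "real \<Rightarrow> real" where
  "jzero \<nu> = Inf {r. r > 0 \<and> besselJ \<nu> r = 0}"

definition fnu :: "nat \<Rightarrow> real \<Rightarrow> real" where
  "fnu d r = r^(d-1) * (besselJ (nu d + 1) r / besselJ (nu d) r + besselI (nu d + 1) r / besselI (nu d) r)"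

definition gnu :: "nat \<Rightarrow> real \<Rightarrow> real" where
  "gnu d r = r powr (1 - real d) * (besselJ (nu d + 1) r / besselJ (nu d) r - besselI (nu d + 1) r / besselI (nu d) r)"

definition kzero :: "nat \<Rightarrow> real" where
  "kzero d = Inf {r. r > 0 \<and> fnu d r = 0}"

definition bfun :: "nat \<Rightarrow> real \<Rightarrow> real" where
  "bfun d a = root d (1 - a^d)"

definition Kfun :: "nat \<Rightarrow> real \<Rightarrow> real" where
  "Kfun d a = a^(d-1) / (1 + (bfun d a)^(d-1))"

definition Kder :: "nat \<Rightarrow> real \<Rightarrow> real" where
  "Kder d a = deriv (Kfun d) a"

definition aI :: "nat \<Rightarrow> real" where
  "aI d = (THE a. 0 \<le> a \<and> a \<le> 1 \<and> bfun d a = jzero (nu d) / kzero d)"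

definition aS :: "nat \<Rightarrow> real" where
  "aS d = (THE a. 0 \<le> a \<and> a \<le> 1 \<and> a * Kfun d a = jzero (nu d) / kzero d)"

definition T1 :: "nat \<Rightarrow> real \<Rightarrow> real" where
  "T1 d a = (a * Kfun d a)^d * Kder d a / Kfun d a"

definition G1 :: "nat \<Rightarrow> real \<Rightarrow> real" where
  "G1 d a = (a * Kder d a + Kfun d a) * (kzero d * Kfun d a)^(d-1)
              * gnu d (kzero d * a * Kfun d a)"

definition G2 :: "nat \<Rightarrow> real \<Rightarrow> real" where
  "G2 d a = (kzero d)^(d-1) * gnu d (kzero d * bfun d a)"

definition Fnu :: "nat \<Rightarrow> real \<Rightarrow> real \<Rightarrow> real" where
  "Fnu d k a = fnu d (k * Kfun d a * a) + (Kfun d a)^d * fnu d (k * bfun d a)"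

end

theory Submission
  imports Defs
begin

text \<open>
  Write \<open>P = J\<^bsub>\<nu>+1\<^esub> / J\<^bsub>\<nu>\<^esub>\<close> and \<open>Q = I\<^bsub>\<nu>+1\<^esub> / I\<^bsub>\<nu>\<^esub>\<close>. They solve the Riccati equations
  \<open>P' = 1 + P\<^sup>2 - (d - 1) P / r\<close> and \<open>Q' = 1 - Q\<^sup>2 - (d - 1) Q / r\<close>, so that
  \<open>f' = r\<^bsup>d-1\<^esup> (2 + f g)\<close> with \<open>f g = P\<^sup>2 - Q\<^sup>2\<close>, and \<open>f\<close> increases on \<open>(0, j)\<close> and on \<open>(j, k]\<close>.
  Comparison with explicit sub- and supersolutions gives \<open>j \<ge> (d + 2) / 2\<close> and
  \<open>k \<le> j (1 + 2 / d)\<close>, whence \<open>2 (j / k)\<^sup>d + j / k > 1\<close>, that is \<open>a\<^sub>I < a\<^sub>S\<close>: the two arguments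
  \<open>k a K(a)\<close> and \<open>k b(a)\<close> of \<open>f\<close> are always on opposite sides of the pole \<open>j\<close> in the ranges considered.
  On the inner intervals of both subdivisions the claim follows from the monotonicity of \<open>f\<close>, \<open>K\<close>
  and \<open>b\<close>. On \<open>[0, x\<^sub>1]\<close> a Gronwall argument applies to \<open>F / K\<^sup>d\<close>, and on \<open>[y\<^sub>m, 1]\<close> the function
  \<open>F\<close> is nondecreasing with \<open>F(1) = 0\<close>.
\<close>

section \<open>Comparison and first-zero tools for real functions\<close>

text \<open>After the last point with \<open>w \<ge> 0\<close> the function
  \<open>exp (- M * r) * w r\<close> is nondecreasing, so \<open>w\<close> cannot end up negative.
  The differential inequality is asked for only where \<open>w\<close> is negative, which suits
  comparison with sub- and supersolutions.\<close>

lemma nonneg_if_deriv_ge_linear: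
  fixes w w' :: "real \<Rightarrow> real"
  assumes "a \<le> b" and cont: "continuous_on {a..b} w" and "0 \<le> w a"
    and deriv: "\<And>r. a < r \<Longrightarrow> r < b \<Longrightarrow> (w has_real_derivative w' r) (at r)"
    and ge: "\<And>r. a < r \<Longrightarrow> r < b \<Longrightarrow> w r < 0 \<Longrightarrow> M * w r \<le> w' r"
  shows "0 \<le> w b"
proof (rule ccontr)
  assume neg: "\<not> 0 \<le> w b"
  have "closed {r \<in> {a..b}. 0 \<le> w r}"
    using cont by (intro continuous_on_closed_Collect_le) (auto intro: continuous_intros)
  moreover have "{r \<in> {a..b}. 0 \<le> w r} = {r \<in> {a..b}. 0 \<le> w r} \<inter> {a..b}" by auto
  ultimately have "compact {r \<in> {a..b}. 0 \<le> w r}"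
    by (metis compact_Icc closed_Int_compact)
  moreover have "a \<in> {r \<in> {a..b}. 0 \<le> w r}" using assms by auto
  ultimately obtain s where s: "s \<in> {a..b}" "0 \<le> w s"
    and smax: "\<And>r. r \<in> {a..b} \<Longrightarrow> 0 \<le> w r \<Longrightarrow> r \<le> s"
    by (metis (mono_tags, lifting) compact_attains_sup empty_iff mem_Collect_eq)
  have sb: "s < b" using s neg by (cases "s = b") auto
  define z where "z r = exp (- M * r) * w r" for r
  have "z s \<le> z b"
  proof (rule DERIV_nonneg_imp_increasing_open[of s b z])
    show "s \<le> b" using sb by simp
    fix r assume r: "s < r" "r < b"
    then have lt: "w r < 0" using smax[of r] s by force
    have "(z has_real_derivative exp (- M * r) * (w' r - M * w r)) (at r)"
      unfolding z_def using deriv[of r] r s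
      by (auto intro!: derivative_eq_intros simp: algebra_simps)
    moreover have "0 \<le> exp (- M * r) * (w' r - M * w r)"
      using ge[of r] r s lt by auto
    ultimately show "\<exists>y. (z has_real_derivative y) (at r) \<and> 0 \<le> y" by blast
  next
    show "continuous_on {s..b} z"
      unfolding z_def using cont s
      by (intro continuous_intros) (auto elim: continuous_on_subset)
  qed
  moreover have "0 \<le> z s" "z b < 0"
    using s neg by (auto simp: z_def mult_pos_neg)
  ultimately show False by linarith
qed

text \<open>Compactness gives the least point with \<open>h \<le> 0\<close>, and the intermediate
  value theorem makes it a zero. Positivity before it later identifies it with the infima in
  \<open>jzero\<close> and \<open>kzero\<close>.\<close>

lemma first_zero:
  fixes h :: "real \<Rightarrow> real"
  assumes cont: "continuous_on {a..b} h" and "0 < h a" "a \<le> b" "h b \<le> 0"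
  obtains z where "a < z" "z \<le> b" "h z = 0" "\<And>r. a \<le> r \<Longrightarrow> r < z \<Longrightarrow> 0 < h r"
proof -
  have "closed {r \<in> {a..b}. h r \<le> 0}"
    using cont by (intro continuous_on_closed_Collect_le) (auto intro: continuous_intros)
  moreover have "{r \<in> {a..b}. h r \<le> 0} = {r \<in> {a..b}. h r \<le> 0} \<inter> {a..b}" by auto
  ultimately have "compact {r \<in> {a..b}. h r \<le> 0}"
    by (metis compact_Icc closed_Int_compact)
  moreover have "b \<in> {r \<in> {a..b}. h r \<le> 0}" using assms by auto
  ultimately obtain z where z: "z \<in> {a..b}" "h z \<le> 0"
    and zmin: "\<And>r. r \<in> {a..b} \<Longrightarrow> h r \<le> 0 \<Longrightarrow> z \<le> r"
    by (metis (mono_tags, lifting) compact_attains_inf empty_iff mem_Collect_eq)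
  have "\<exists>r\<ge>a. r \<le> z \<and> h r = 0"
    using z \<open>0 < h a\<close> by (intro IVT2') (auto intro: continuous_on_subset[OF cont])
  then have "h z = 0" using zmin z by force
  moreover have "a < z" using z \<open>0 < h a\<close> by (cases "a = z") auto
  moreover have "0 < h r" if "a \<le> r" "r < z" for r using zmin[of r] that z by force
  ultimately show thesis using that z by auto
qed

section \<open>Bessel series\<close>

text \<open>The regularised hypergeometric function 0F1(; mu + 1; x). Evaluated at -(r/2)^2 and
  (r/2)^2 it is the entire factor of the Bessel and the modified Bessel function, so both are
  treated by one power series.\<close>

definition bessel_series :: "real \<Rightarrow> real \<Rightarrow> real" where
  "bessel_series \<mu> x = (\<Sum>n. 1 / (fact n * Gamma (real n + \<mu> + 1)) * x ^ n)"

lemma Gamma_add_nat_ge: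
  fixes \<mu> :: real
  assumes "0 \<le> \<mu>"
  shows "Gamma (\<mu> + 1) \<le> Gamma (real n + \<mu> + 1)"
proof (induction n)
  case (Suc n)
  have "Gamma (real n + \<mu> + 1) * 1 \<le> Gamma (real n + \<mu> + 1) * (real n + \<mu> + 1)"
    using assms by (intro mult_left_mono) (auto intro: less_imp_le Gamma_real_pos)
  also have "\<dots> = Gamma (real (Suc n) + \<mu> + 1)"
    using Gamma_plus1[of "real n + \<mu> + 1"] assms
    by (metis (no_types, opaque_lifting) add.assoc add.commute add_pos_nonneg linorder_not_less
      mult.commute nonpos_Ints_nonpos of_nat_0_le_iff of_nat_Suc zero_less_one)
  finally show ?case using Suc by simp
qed simp

lemma summable_bessel_series:
  fixes \<mu> x :: real
  assumes "0 \<le> \<mu>"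
  shows "summable (\<lambda>n. 1 / (fact n * Gamma (real n + \<mu> + 1)) * x ^ n)"
proof (rule summable_comparison_test')
  show "summable (\<lambda>n. inverse (Gamma (\<mu> + 1)) * (inverse (fact n) * \<bar>x\<bar> ^ n))"
    by (intro summable_mult summable_exp)
  fix n :: nat
  have pos: "0 < Gamma (\<mu> + 1)" using assms by (intro Gamma_real_pos) auto
  have le: "inverse (Gamma (real n + \<mu> + 1)) \<le> inverse (Gamma (\<mu> + 1))"
    using Gamma_add_nat_ge[OF assms, of n] pos by (intro le_imp_inverse_le) auto
  have "norm (1 / (fact n * Gamma (real n + \<mu> + 1)) * x ^ n)
      = inverse (Gamma (real n + \<mu> + 1)) * (inverse (fact n) * \<bar>x\<bar> ^ n)"
    using Gamma_add_nat_ge[OF assms, of n] pos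
    by (simp add: abs_mult power_abs field_simps)
  also have "\<dots> \<le> inverse (Gamma (\<mu> + 1)) * (inverse (fact n) * \<bar>x\<bar> ^ n)"
    using le by (intro mult_right_mono) auto
  finally show "norm (1 / (fact n * Gamma (real n + \<mu> + 1)) * x ^ n)
      \<le> inverse (Gamma (\<mu> + 1)) * (inverse (fact n) * \<bar>x\<bar> ^ n)" .
qed

lemma DERIV_bessel_series:
  assumes "0 \<le> \<mu>"
  shows "(bessel_series \<mu> has_real_derivative bessel_series (\<mu> + 1) x) (at x)"
proof -
  let ?c = "\<lambda>n. 1 / (fact n * Gamma (real n + \<mu> + 1))"
  have "((\<lambda>x. \<Sum>n. ?c n * x ^ n) has_real_derivative (\<Sum>n. diffs ?c n * x ^ n)) (at x)"
    using summable_bessel_series[OF assms] by (intro termdiffs_strong_converges_everywhere)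
  moreover have "diffs ?c n = 1 / (fact n * Gamma (real n + (\<mu> + 1) + 1))" for n
    by (simp add: diffs_def field_simps del: of_nat_Suc) (simp add: algebra_simps)
  ultimately show ?thesis unfolding bessel_series_def[abs_def] by simp
qed

lemma DERIV_bessel_series_compose [derivative_intros]:
  assumes "0 \<le> \<mu>" and "(g has_real_derivative g') (at x within S)"
  shows "((\<lambda>x. bessel_series \<mu> (g x)) has_real_derivative bessel_series (\<mu> + 1) (g x) * g') (at x within S)"
  using DERIV_chain2[OF DERIV_bessel_series[OF assms(1)] assms(2)] .

lemma continuous_on_bessel_series [continuous_intros]:
  assumes "0 \<le> \<mu>" "continuous_on S g"
  shows "continuous_on S (\<lambda>x. bessel_series \<mu> (g x))"
proof -
  have "continuous_on UNIV (bessel_series \<mu>)"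
    using DERIV_bessel_series[OF assms(1)] by (auto intro!: DERIV_isCont continuous_at_imp_continuous_on)
  then show ?thesis using continuous_on_compose2[OF _ assms(2)] by blast
qed

text \<open>The three-term Bessel recurrence for both signs of \<open>x\<close> at once: the factor
  n + mu + 1 relating consecutive Gamma values is split into mu + 1 and n, and the n cancels against
  n!.\<close>

lemma bessel_series_recurrence:
  assumes "0 \<le> \<mu>"
  shows "bessel_series \<mu> x = (\<mu> + 1) * bessel_series (\<mu> + 1) x + x * bessel_series (\<mu> + 2) x"
proof -
  let ?c = "\<lambda>\<mu> n. 1 / (fact n * Gamma (real n + \<mu> + 1))"
  have s: "summable (\<lambda>n. ?c (\<mu> + i) n * x ^ n)" if "0 \<le> i" for i
    using summable_bessel_series[of "\<mu> + i" x] assms that by simp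
  have eq: "?c \<mu> n = (\<mu> + 1) * ?c (\<mu> + 1) n + real n * ?c (\<mu> + 1) n" for n
  proof -
    have nz: "real n + \<mu> + 1 > 0" using assms by simp
    have "Gamma (real n + (\<mu> + 1) + 1) = (real n + \<mu> + 1) * Gamma (real n + \<mu> + 1)"
      using Gamma_plus1[of "real n + \<mu> + 1"] nz by (force simp: add_ac dest: nonpos_Ints_nonpos)
    moreover have "Gamma (real n + \<mu> + 1) \<noteq> 0" using Gamma_real_pos[OF nz] by simp
    ultimately have "(\<mu> + 1) * ?c (\<mu> + 1) n + real n * ?c (\<mu> + 1) n
        = (real n + \<mu> + 1) * 1 / ((real n + \<mu> + 1) * (fact n * Gamma (real n + \<mu> + 1)))"
      by (simp add: add_divide_distrib algebra_simps)
    also have "\<dots> = ?c \<mu> n" using nz by simp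
    finally show ?thesis by simp
  qed
  \<comment> \<open>The part carrying the factor n; its zeroth term vanishes, so shifting the index
    by one does not change the sum.\<close>
  define e where "e n = real n * ?c (\<mu> + 1) n * x ^ n" for n
  have shift: "e (Suc n) = x * (?c (\<mu> + 2) n * x ^ n)" for n
    by (simp add: e_def field_simps del: of_nat_Suc) (simp add: algebra_simps)
  have "(\<lambda>n. e (Suc n)) sums (x * bessel_series (\<mu> + 2) x)"
    unfolding shift bessel_series_def by (intro sums_mult summable_sums s) simp
  then have "e sums (x * bessel_series (\<mu> + 2) x)"
    by (subst (asm) sums_Suc_iff) (simp add: e_def)
  moreover have "(\<lambda>n. (\<mu> + 1) * (?c (\<mu> + 1) n * x ^ n)) sums ((\<mu> + 1) * bessel_series (\<mu> + 1) x)"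
    unfolding bessel_series_def by (intro sums_mult summable_sums s) simp
  ultimately have "(\<lambda>n. (\<mu> + 1) * (?c (\<mu> + 1) n * x ^ n) + e n)
      sums ((\<mu> + 1) * bessel_series (\<mu> + 1) x + x * bessel_series (\<mu> + 2) x)"
    using sums_add by blast
  moreover have "(\<mu> + 1) * (?c (\<mu> + 1) n * x ^ n) + e n = ?c \<mu> n * x ^ n" for n
    unfolding e_def eq[of n] by (simp only: algebra_simps)
  ultimately show ?thesis unfolding bessel_series_def[of \<mu>] by (simp add: sums_iff)
qed

lemma bessel_series_pos:
  assumes "0 \<le> \<mu>" "0 \<le> x"
  shows "0 < bessel_series \<mu> x"
  unfolding bessel_series_def
proof (rule suminf_pos2[where i = 0])
  have pos: "0 < Gamma (real n + \<mu> + 1)" for n using assms by (intro Gamma_real_pos) auto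
  show "0 \<le> 1 / (fact n * Gamma (real n + \<mu> + 1)) * x ^ n" for n
    using pos[of n] assms by simp
  show "0 < 1 / (fact 0 * Gamma (real 0 + \<mu> + 1)) * x ^ 0" using pos[of 0] by simp
qed (rule summable_bessel_series[OF assms(1)])

lemma besselJ_eq:
  assumes "0 \<le> \<mu>"
  shows "besselJ \<mu> r = (r/2) powr \<mu> * bessel_series \<mu> (- ((r/2)\<^sup>2))"
proof -
  have "(-1)^k / (fact k * Gamma (real k + \<mu> + 1)) * (r/2) powr \<mu> * (r/2)^(2*k)
     = (r/2) powr \<mu> * (1 / (fact k * Gamma (real k + \<mu> + 1)) * (- ((r/2)\<^sup>2)) ^ k)" for k
    by (simp add: power_mult power_minus[of "(r/2)\<^sup>2"] del: power_divide)
  then show ?thesis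
    unfolding besselJ_def bessel_series_def
    by (simp only: suminf_mult[OF summable_bessel_series[OF assms]])
qed

lemma besselI_eq:
  assumes "0 \<le> \<mu>"
  shows "besselI \<mu> r = (r/2) powr \<mu> * bessel_series \<mu> ((r/2)\<^sup>2)"
proof -
  have "1 / (fact k * Gamma (real k + \<mu> + 1)) * (r/2) powr \<mu> * (r/2)^(2*k)
     = (r/2) powr \<mu> * (1 / (fact k * Gamma (real k + \<mu> + 1)) * ((r/2)\<^sup>2) ^ k)" for k
    by (simp add: power_mult del: power_divide)
  then show ?thesis
    unfolding besselI_def bessel_series_def
    by (simp only: suminf_mult[OF summable_bessel_series[OF assms]])
qed

section \<open>Riccati equations and the first zeros\<close>

locale bessel_dim =
  fixes d :: nat
  assumes d_ge_4: "4 \<le> d"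
begin

text \<open>\<open>J0\<close>, \<open>J1\<close>, \<open>I0\<close>, \<open>I1\<close> are \<open>J\<^bsub>\<nu>\<^esub>\<close>, \<open>J\<^bsub>\<nu>+1\<^esub>\<close>, \<open>I\<^bsub>\<nu>\<^esub>\<close>, \<open>I\<^bsub>\<nu>+1\<^esub>\<close> divided by \<open>(r / 2)\<^bsup>\<nu>\<^esup>\<close>.\<close>

definition J0 :: "real \<Rightarrow> real" where
  "J0 r = bessel_series (nu d) (- ((r/2)\<^sup>2))"

definition J1 :: "real \<Rightarrow> real" where
  "J1 r = r/2 * bessel_series (nu d + 1) (- ((r/2)\<^sup>2))"

definition I0 :: "real \<Rightarrow> real" where
  "I0 r = bessel_series (nu d) ((r/2)\<^sup>2)"

definition I1 :: "real \<Rightarrow> real" where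
  "I1 r = r/2 * bessel_series (nu d + 1) ((r/2)\<^sup>2)"

definition P :: "real \<Rightarrow> real" where "P r = J1 r / J0 r"

definition Q :: "real \<Rightarrow> real" where "Q r = I1 r / I0 r"

lemma real_d_ge_4: "4 \<le> real d"
  using d_ge_4 by simp

lemma nu_nonneg: "0 \<le> nu d"
  using real_d_ge_4 by (simp add: nu_def)

lemma DERIV_J0: "(J0 has_real_derivative - J1 r) (at r)"
  unfolding J0_def[abs_def] J1_def
  by (auto intro!: derivative_eq_intros nu_nonneg)

lemma DERIV_I0: "(I0 has_real_derivative I1 r) (at r)"
  unfolding I0_def[abs_def] I1_def
  by (auto intro!: derivative_eq_intros nu_nonneg)

text \<open>Differentiation raises the order to nu + 2; the recurrence brings it back to nu and nu +
  1. The coefficient matches because nu + 1/2 = (d - 1)/2.\<close>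

lemma DERIV_J1:
  assumes "0 < r"
  shows "(J1 has_real_derivative J0 r - (real d - 1) / r * J1 r) (at r)"
proof -
  let ?x = "- ((r/2)\<^sup>2)"
  have "(J1 has_real_derivative bessel_series (nu d + 1) ?x / 2 + ?x * bessel_series (nu d + 2) ?x) (at r)"
    unfolding J1_def[abs_def] using nu_nonneg
    by (auto intro!: derivative_eq_intros simp: power2_eq_square add.assoc)
  moreover have "bessel_series (nu d + 1) ?x / 2 + ?x * bessel_series (nu d + 2) ?x
      = J0 r - (real d - 1) / r * J1 r"
  proof -
    have "(real d - 1) / r * J1 r = (nu d + 1 / 2) * bessel_series (nu d + 1) ?x"
      using assms by (simp add: J1_def nu_def field_simps)
    then show ?thesis
      using bessel_series_recurrence[OF nu_nonneg, of ?x] by (simp add: J0_def algebra_simps)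
  qed
  ultimately show ?thesis by simp
qed

lemma DERIV_I1:
  assumes "0 < r"
  shows "(I1 has_real_derivative I0 r - (real d - 1) / r * I1 r) (at r)"
proof -
  let ?x = "(r/2)\<^sup>2"
  have "(I1 has_real_derivative bessel_series (nu d + 1) ?x / 2 + ?x * bessel_series (nu d + 2) ?x) (at r)"
    unfolding I1_def[abs_def] using nu_nonneg
    by (auto intro!: derivative_eq_intros simp: power2_eq_square add.assoc)
  moreover have "bessel_series (nu d + 1) ?x / 2 + ?x * bessel_series (nu d + 2) ?x
      = I0 r - (real d - 1) / r * I1 r"
  proof -
    have "(real d - 1) / r * I1 r = (nu d + 1 / 2) * bessel_series (nu d + 1) ?x"
      using assms by (simp add: I1_def nu_def field_simps)
    then show ?thesis
      using bessel_series_recurrence[OF nu_nonneg, of ?x] by (simp add: I0_def algebra_simps)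
  qed
  ultimately show ?thesis by simp
qed

lemma continuous_on_J0 [continuous_intros]: "continuous_on S J0"
  unfolding J0_def[abs_def] using nu_nonneg by (intro continuous_intros) auto

lemma continuous_on_J1 [continuous_intros]: "continuous_on S J1"
  unfolding J1_def[abs_def] using nu_nonneg by (intro continuous_intros) auto

lemma continuous_on_I0 [continuous_intros]: "continuous_on S I0"
  unfolding I0_def[abs_def] using nu_nonneg by (intro continuous_intros) auto

lemma continuous_on_I1 [continuous_intros]: "continuous_on S I1"
  unfolding I1_def[abs_def] using nu_nonneg by (intro continuous_intros) auto

lemma I0_pos: "0 < I0 r"
  unfolding I0_def by (intro bessel_series_pos nu_nonneg) simp

lemma I1_pos: "0 < r \<Longrightarrow> 0 < I1 r"
  unfolding I1_def using bessel_series_pos[of "nu d + 1" "(r/2)\<^sup>2"] nu_nonneg by simp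

lemma J0_0_pos: "0 < J0 0"
  using bessel_series_pos[OF nu_nonneg, of 0] by (simp add: J0_def)

lemma J1_0 [simp]: "J1 0 = 0" and I1_0 [simp]: "I1 0 = 0"
  by (simp_all add: J1_def I1_def)

lemma Q_pos: "0 < r \<Longrightarrow> 0 < Q r"
  by (simp add: Q_def I0_pos I1_pos)

lemma bessel_ratio_eq:
  assumes "0 < r"
  shows "besselJ (nu d + 1) r / besselJ (nu d) r = P r"
    and "besselI (nu d + 1) r / besselI (nu d) r = Q r"
  using assms nu_nonneg
  by (simp_all add: besselJ_eq besselI_eq P_def Q_def J0_def J1_def I0_def I1_def powr_add)

lemma fnu_eq:
  assumes "0 \<le> r"
  shows "fnu d r = r ^ (d - 1) * (P r + Q r)"
  using assms d_ge_4 by (cases "r = 0") (auto simp: fnu_def bessel_ratio_eq)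

lemma gnu_eq:
  assumes "0 < r"
  shows "gnu d r = (P r - Q r) / r ^ (d - 1)"
proof -
  have "1 - real d = - real (d - 1)" using d_ge_4 by simp
  then have "r powr (1 - real d) = inverse (r ^ (d - 1))"
    using assms by (metis powr_minus powr_realpow)
  then show ?thesis by (simp add: gnu_def bessel_ratio_eq[OF assms] divide_inverse[of "P r - Q r"])
qed

lemma besselJ_zero_iff: "0 < r \<Longrightarrow> besselJ (nu d) r = 0 \<longleftrightarrow> J0 r = 0"
  by (simp add: besselJ_eq nu_nonneg J0_def)

section \<open>Riccati equations and elementary bounds for the ratio Q\<close>

lemma DERIV_P:
  assumes "0 < r" "J0 r \<noteq> 0"
  shows "(P has_real_derivative 1 + (P r)\<^sup>2 - (real d - 1) / r * P r) (at r)"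
proof -
  have "(P has_real_derivative
      ((J0 r - (real d - 1) / r * J1 r) * J0 r - J1 r * (- J1 r)) / (J0 r * J0 r)) (at r)"
    unfolding P_def[abs_def] by (intro DERIV_divide DERIV_J0 DERIV_J1 assms)
  moreover have "((J0 r - (real d - 1) / r * J1 r) * J0 r - J1 r * (- J1 r)) / (J0 r * J0 r)
      = 1 + (P r)\<^sup>2 - (real d - 1) / r * P r"
    using assms by (simp add: P_def power2_eq_square divide_simps) algebra
  ultimately show ?thesis by simp
qed

lemma DERIV_Q:
  assumes "0 < r"
  shows "(Q has_real_derivative 1 - (Q r)\<^sup>2 - (real d - 1) / r * Q r) (at r)"
proof -
  have nz: "I0 r \<noteq> 0" using I0_pos[of r] by simp
  have "(Q has_real_derivative
      ((I0 r - (real d - 1) / r * I1 r) * I0 r - I1 r * I1 r) / (I0 r * I0 r)) (at r)"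
    unfolding Q_def[abs_def] by (intro DERIV_divide DERIV_I0 DERIV_I1 assms nz)
  moreover have "((I0 r - (real d - 1) / r * I1 r) * I0 r - I1 r * I1 r) / (I0 r * I0 r)
      = 1 - (Q r)\<^sup>2 - (real d - 1) / r * Q r"
    using assms nz by (simp add: Q_def power2_eq_square divide_simps) algebra
  ultimately show ?thesis by simp
qed

text \<open>The function \<open>exp r * (I0 r - I1 r)\<close> is positive at 0 and has derivative
  \<open>exp r * (d - 1) / r * I1 r \<ge> 0\<close>.\<close>

lemma Q_less_1:
  assumes "0 \<le> r"
  shows "Q r < 1"
proof -
  define w where "w r = exp r * (I0 r - I1 r)" for r
  have "w 0 \<le> w r"
  proof (rule DERIV_nonneg_imp_increasing_open[of 0 r w])
    fix x :: real assume x: "0 < x" "x < r"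
    have "(w has_real_derivative exp x * ((real d - 1) / x * I1 x)) (at x)"
      unfolding w_def[abs_def]
      by (rule derivative_eq_intros DERIV_I0 DERIV_I1 x refl)+ (simp add: algebra_simps)
    moreover have "0 \<le> exp x * ((real d - 1) / x * I1 x)"
      using I1_pos[of x] x real_d_ge_4 by simp
    ultimately show "\<exists>y. (w has_real_derivative y) (at x) \<and> 0 \<le> y" by blast
  next
    show "continuous_on {0..r} w" unfolding w_def[abs_def] by (intro continuous_intros)
  qed fact
  then have "0 < exp r * (I0 r - I1 r)" using I0_pos[of 0] by (simp add: w_def)
  then have "I1 r < I0 r" by (simp add: zero_less_mult_iff)
  then show ?thesis using I0_pos[of r] by (simp add: Q_def)
qed

text \<open>The function r / (r + d) is a subsolution of the Riccati equation for \<open>Q\<close>.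
  The comparison runs on the linear expression \<open>I1 - h * I0\<close>, as do the later
  comparisons for \<open>P\<close>, where this form stays regular at the pole.\<close>

lemma Q_ge:
  assumes "0 \<le> r"
  shows "r / (r + real d) \<le> Q r"
proof -
  define h where "h r = r / (r + real d)" for r
  define h' where "h' r = real d / (r + real d)\<^sup>2" for r
  have dpos: "0 < real d" using real_d_ge_4 by simp
  have "0 \<le> I1 r - h r * I0 r"
  proof (rule nonneg_if_deriv_ge_linear[where a = 0 and b = r and M = 0
        and w = "\<lambda>r. I1 r - h r * I0 r"
        and w' = "\<lambda>x. I0 x - (real d - 1) / x * I1 x - (h' x * I0 x + h x * I1 x)"])
    show "continuous_on {0..r} (\<lambda>r. I1 r - h r * I0 r)"
      unfolding h_def[abs_def] using dpos by (intro continuous_intros) auto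
    fix x assume x: "0 < x" "x < r"
    have h: "(h has_real_derivative h' x) (at x)"
      unfolding h_def[abs_def] h'_def using x dpos
      by (auto intro!: derivative_eq_intros simp: power2_eq_square)
    show "((\<lambda>r. I1 r - h r * I0 r) has_real_derivative
        I0 x - (real d - 1) / x * I1 x - (h' x * I0 x + h x * I1 x)) (at x)"
      by (rule derivative_eq_intros DERIV_I0 DERIV_I1 x h refl)+ simp
    assume neg: "I1 x - h x * I0 x < 0"
    have pos: "0 < x + real d" using x dpos by simp
    have "1 - (h x)\<^sup>2 - (real d - 1) / x * h x - h' x = x * (real d + 1) / (x + real d)\<^sup>2"
      using x pos unfolding h_def h'_def
      by (simp add: divide_simps) (simp add: power2_eq_square algebra_simps)
    then have "0 \<le> 1 - (h x)\<^sup>2 - (real d - 1) / x * h x - h' x" using x by simp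
    then have "0 \<le> I0 x * (1 - (h x)\<^sup>2 - (real d - 1) / x * h x - h' x)"
      using I0_pos[of x] by simp
    moreover have "0 \<le> ((real d - 1) / x + h x) * (- (I1 x - h x * I0 x))"
      using neg x real_d_ge_4 by (intro mult_nonneg_nonneg add_nonneg_nonneg) (auto simp: h_def)
    ultimately show "0 * (I1 x - h x * I0 x) \<le> I0 x - (real d - 1) / x * I1 x - (h' x * I0 x + h x * I1 x)"
      by (simp add: algebra_simps power2_eq_square)
  qed (use assms in \<open>auto simp: h_def\<close>)
  then show ?thesis using I0_pos[of r] by (simp add: Q_def h_def field_simps)
qed

text \<open>The integrating factor r^(d-1) absorbs the damping term (d - 1) F / r shared by all
  first-order equations here.\<close>

lemma DERIV_power_weight:
  assumes "0 < r" and F: "(F has_real_derivative E - (real d - 1) / r * F r) (at r)"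
  shows "((\<lambda>r. r ^ (d - 1) * F r) has_real_derivative r ^ (d - 1) * E) (at r)"
proof -
  have "((\<lambda>r. r ^ (d - 1) * F r) has_real_derivative
      real (d - 1) * r ^ (d - 1 - Suc 0) * F r + (E - (real d - 1) / r * F r) * r ^ (d - 1)) (at r)"
    by (rule DERIV_mult DERIV_pow F)+
  moreover have "r ^ (d - 1) = r * r ^ (d - 1 - Suc 0)"
    using d_ge_4 by (intro power_eq_if[THEN trans]) auto
  then have "real (d - 1) * r ^ (d - 1 - Suc 0) * F r + (E - (real d - 1) / r * F r) * r ^ (d - 1)
      = r ^ (d - 1) * E"
    using assms d_ge_4 by (simp add: of_nat_diff field_simps)
  ultimately show ?thesis by simp
qed

section \<open>The first zero j of J_nu and its lower bound\<close>

text \<open>The weighted function r^(d-1) \<open>J1\<close> vanishes at 0 and has derivative r^(d-1)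
  \<open>J0\<close>.\<close>

lemma J1_pos:
  assumes "0 < r" and pos: "\<And>x. 0 < x \<Longrightarrow> x < r \<Longrightarrow> 0 < J0 x"
  shows "0 < J1 r"
proof -
  define w where "w r = r ^ (d - 1) * J1 r" for r
  have "w 0 < w r"
  proof (rule DERIV_pos_imp_increasing_open[of 0 r w])
    fix x :: real assume x: "0 < x" "x < r"
    have "(w has_real_derivative x ^ (d - 1) * J0 x) (at x)"
      unfolding w_def[abs_def] by (intro DERIV_power_weight DERIV_J1 x)
    then show "\<exists>y. (w has_real_derivative y) (at x) \<and> 0 < y"
      using pos[OF x] x by (intro exI[of _ "x ^ (d - 1) * J0 x"]) simp
  next
    show "continuous_on {0..r} w" unfolding w_def[abs_def] by (intro continuous_intros)
  qed fact
  then show ?thesis using \<open>0 < r\<close> by (simp add: w_def zero_less_mult_iff)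
qed

text \<open>A positive solution of the Riccati equation for \<open>P\<close> blows up in finite time.\<close>

lemma J0_has_zero: "\<exists>r>0. J0 r \<le> 0"
proof (rule ccontr)
  assume "\<not> ?thesis"
  then have pos: "0 < J0 r" if "0 < r" for r using that by force
  \<comment> \<open>Beyond d - 1 the coefficient (d - 1)/r is at most 1, whence P' is at least (1 +
    P^2)/2.\<close>
  define c where "c = real d - 1"
  have c: "0 < c" using real_d_ge_4 by (simp add: c_def)
  have P: "0 < P r" if "0 < r" for r
    using pos[OF that] J1_pos[OF that] pos by (simp add: P_def)
  \<comment> \<open>By the previous bound arctan P grows at rate at least 1/2, so it would gain pi
    over an interval of length 2 pi and exceed pi/2.\<close>
  define w where "w r = arctan (P r) - r / 2" for r
  have "w c \<le> w (c + 2 * pi)"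
  proof (rule DERIV_nonneg_imp_nondecreasing[of c "c + 2 * pi" w])
    show "c \<le> c + 2 * pi" by simp
    fix x assume "c \<le> x"
    then have x: "0 < x" using c by simp
    let ?P' = "1 + (P x)\<^sup>2 - (real d - 1) / x * P x"
    have "(w has_real_derivative inverse (1 + (P x)\<^sup>2) * ?P' - 1 / 2) (at x)"
      unfolding w_def[abs_def] using pos[OF x]
      by (auto intro!: derivative_eq_intros DERIV_P x)
    moreover have "0 \<le> inverse (1 + (P x)\<^sup>2) * ?P' - 1 / 2"
    proof -
      have "(real d - 1) / x * P x \<le> 1 * P x"
        using P[OF x] \<open>c \<le> x\<close> x by (intro mult_right_mono) (auto simp: c_def)
      also have "\<dots> \<le> (1 + (P x)\<^sup>2) / 2"
        using sum_squares_bound[of 1 "P x"] by simp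
      finally have "1 / 2 * (1 + (P x)\<^sup>2) \<le> ?P'" by simp
      moreover have "0 < 1 + (P x)\<^sup>2" by (simp add: add_pos_nonneg)
      ultimately show ?thesis by (simp add: field_simps)
    qed
    ultimately show "\<exists>y. (w has_real_derivative y) (at x) \<and> 0 \<le> y" by blast
  qed
  then have "arctan (P c) + pi \<le> arctan (P (c + 2 * pi))" by (simp add: w_def field_simps)
  moreover have "0 < arctan (P c)" using P[OF c] by simp
  ultimately have "pi < arctan (P (c + 2 * pi))" by linarith
  then show False using arctan_ubound[of "P (c + 2 * pi)"] pi_gt_zero by linarith
qed

abbreviation j :: real where "j \<equiv> jzero (nu d)"

lemma jzero_props: "0 < j \<and> J0 j = 0 \<and> (\<forall>r. 0 \<le> r \<longrightarrow> r < j \<longrightarrow> 0 < J0 r)"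
proof -
  obtain b where b: "0 < b" "J0 b \<le> 0" using J0_has_zero by blast
  obtain z where z: "0 < z" "J0 z = 0" "\<And>r. 0 \<le> r \<Longrightarrow> r < z \<Longrightarrow> 0 < J0 r"
    using first_zero[of 0 b J0] b J0_0_pos continuous_on_J0 by (metis less_imp_le)
  have "j = z"
    unfolding jzero_def
  proof (rule cInf_eq_minimum)
    show "z \<in> {r. 0 < r \<and> besselJ (nu d) r = 0}" using z by (simp add: besselJ_zero_iff)
    show "z \<le> x" if "x \<in> {r. 0 < r \<and> besselJ (nu d) r = 0}" for x
      using z(3)[of x] that by (force simp: besselJ_zero_iff)
  qed
  then show ?thesis using z by simp
qed

lemma j_pos: "0 < j" and J0_j: "J0 j = 0"
  and J0_pos: "0 \<le> r \<Longrightarrow> r < j \<Longrightarrow> 0 < J0 r"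
  using jzero_props by auto

lemma J1_pos_j: "0 < r \<Longrightarrow> r \<le> j \<Longrightarrow> 0 < J1 r"
  by (rule J1_pos) (auto intro: J0_pos)

lemma P_pos: "0 < r \<Longrightarrow> r < j \<Longrightarrow> 0 < P r"
  by (simp add: P_def J0_pos J1_pos_j)

text \<open>On \<open>(0, (d + 2) / 2]\<close> the function \<open>h r = r / (d - 2 r\<^sup>2 / (d + 2))\<close> is a finite
  supersolution of the Riccati equation for \<open>P\<close>, so \<open>P\<close> cannot blow up there.\<close>

lemma j_ge: "(real d + 2) / 2 \<le> j"
proof (rule ccontr)
  assume "\<not> ?thesis"
  then have lt: "j < (real d + 2) / 2" by simp
  define D where "D = real d"
  have D: "4 \<le> D" using real_d_ge_4 by (simp add: D_def)
  define q where "q r = D - 2 / (D + 2) * r\<^sup>2" for r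
  define h where "h r = r / q r" for r
  define h' where "h' r = (D + 2 / (D + 2) * r\<^sup>2) / (q r)\<^sup>2" for r
  have X: "2 / (D + 2) * x\<^sup>2 \<le> (D + 2) / 2" if "0 \<le> x" "x \<le> j" for x
  proof -
    have "x\<^sup>2 \<le> ((D + 2) / 2)\<^sup>2" using that lt by (intro power_mono) (auto simp: D_def)
    then have "2 / (D + 2) * x\<^sup>2 \<le> 2 / (D + 2) * ((D + 2) / 2)\<^sup>2"
      using D by (intro mult_left_mono) auto
    also have "\<dots> = (D + 2) / 2" using D by (simp add: power2_eq_square field_simps)
    finally show ?thesis .
  qed
  have q: "1 \<le> q x" if "0 \<le> x" "x \<le> j" for x
    using X[OF that] D by (simp add: q_def)
  have "0 \<le> h j * J0 j - J1 j"
  \<comment> \<open>The coefficient of \<open>w\<close> in its own equation is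
    \<open>h x - (D - 1) / x\<close>; since \<open>q \<ge> 1\<close> gives
    \<open>h x \<le> x < j\<close>, the constant \<open>M = j\<close> dominates it.\<close>
  proof (rule nonneg_if_deriv_ge_linear[where a = 0 and b = j and M = j
        and w = "\<lambda>r. h r * J0 r - J1 r"
        and w' = "\<lambda>x. h' x * J0 x - h x * J1 x - (J0 x - (D - 1) / x * J1 x)"])
    show "continuous_on {0..j} (\<lambda>r. h r * J0 r - J1 r)"
    proof -
      have "continuous_on {0..j} q" unfolding q_def[abs_def] by (intro continuous_intros)
      moreover have "\<forall>x\<in>{0..j}. q x \<noteq> 0" using q by force
      ultimately show ?thesis unfolding h_def[abs_def] by (intro continuous_intros)
    qed
    fix x assume x: "0 < x" "x < j"
    have q1: "1 \<le> q x" using q x by simp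
    have h: "(h has_real_derivative h' x) (at x)"
    proof -
      have "(q has_real_derivative - (2 / (D + 2) * (2 * x))) (at x)"
        unfolding q_def[abs_def] using D by (auto intro!: derivative_eq_intros)
      then have "(h has_real_derivative (1 * q x - x * - (2 / (D + 2) * (2 * x))) / (q x * q x)) (at x)"
        unfolding h_def[abs_def] using q1 by (intro DERIV_divide DERIV_ident) auto
      moreover have "1 * q x - x * - (2 / (D + 2) * (2 * x)) = D + 2 / (D + 2) * x\<^sup>2"
        by (simp add: q_def power2_eq_square)
      ultimately show ?thesis by (simp add: h'_def power2_eq_square)
    qed
    show "((\<lambda>r. h r * J0 r - J1 r) has_real_derivative
        h' x * J0 x - h x * J1 x - (J0 x - (D - 1) / x * J1 x)) (at x)"
      unfolding D_def
      by (rule derivative_eq_intros DERIV_J0 DERIV_J1 x h refl)+ simp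
    assume neg: "h x * J0 x - J1 x < 0"
    define X where "X = 2 / (D + 2) * x\<^sup>2"
    have xX: "x\<^sup>2 = (D + 2) / 2 * X" using D by (simp add: X_def)
    have Xb: "0 \<le> X" "X \<le> (D + 2) / 2" using X[of x] x D by (auto simp: X_def)
    have qX: "q x = D - X" by (simp add: q_def X_def)
    have "h' x - (1 + (h x)\<^sup>2 - (D - 1) / x * h x)
        = (D + X - (q x)\<^sup>2 - x\<^sup>2 + (D - 1) * q x) / (q x)\<^sup>2"
      using x q1 unfolding h'_def h_def X_def[symmetric]
      by (simp add: divide_simps) (simp add: power2_eq_square algebra_simps)
    \<comment> \<open>Nonnegative exactly while X <= (D + 2)/2, that is x <= (D + 2)/2: this is the
      source of the bound on j.\<close>
    also have "\<dots> = X * ((D + 2) / 2 - X) / (q x)\<^sup>2"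
      unfolding xX qX by (simp add: power2_eq_square algebra_simps add_divide_distrib)
    finally have "0 \<le> h' x - (1 + (h x)\<^sup>2 - (D - 1) / x * h x)" using Xb by simp
    then have 1: "0 \<le> J0 x * (h' x - (1 + (h x)\<^sup>2 - (D - 1) / x * h x))"
      using J0_pos[of x] x by simp
    have "h x \<le> x" using q1 x by (simp add: h_def field_simps)
    then have "h x - (D - 1) / x \<le> j" using x D by (smt (verit) divide_nonneg_pos)
    then have 2: "0 \<le> (j - (h x - (D - 1) / x)) * (- (h x * J0 x - J1 x))"
      using neg by (intro mult_nonneg_nonneg) auto
    show "j * (h x * J0 x - J1 x) \<le> h' x * J0 x - h x * J1 x - (J0 x - (D - 1) / x * J1 x)"
      using 1 2 by (simp add: algebra_simps power2_eq_square)
  qed (use j_pos in \<open>auto simp: h_def\<close>)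
  \<comment> \<open>As \<open>J0 j = 0\<close>, the comparison at j reads
    \<open>J1 j \<le> 0\<close>.\<close>
  then show False using J1_pos_j[of j] j_pos J0_j by simp
qed

section \<open>The first zero k of f_nu and the bound on k/j\<close>

text \<open>The numerator of P + Q over the denominator \<open>J0 r * I0 r\<close>. Unlike f_nu it
  is continuous through the pole j, so the zeros of f_nu in (j, k] can be found as zeros of
  \<open>N\<close>.\<close>

definition N :: "real \<Rightarrow> real" where
  "N r = J1 r * I0 r + J0 r * I1 r"

lemma continuous_on_N [continuous_intros]: "continuous_on S N"
  unfolding N_def[abs_def] by (intro continuous_intros)

lemma P_plus_Q_eq: "J0 r \<noteq> 0 \<Longrightarrow> P r + Q r = N r / (J0 r * I0 r)"
  using I0_pos[of r] by (simp add: P_def Q_def N_def field_simps)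

lemma N_j: "0 < N j"
  using J1_pos_j[of j] j_pos I0_pos by (simp add: N_def J0_j)

text \<open>With \<open>J0 \<le> 0\<close> the term \<open>J0 * I1\<close> cannot make
  \<open>N\<close> positive, so \<open>J1 * I0\<close> must; this keeps \<open>J0\<close> decreasing
  past j.\<close>

lemma J1_pos_beyond_j:
  assumes "j < r" "J0 r \<le> 0" "0 < N r"
  shows "0 < J1 r"
proof -
  have "J0 r * I1 r \<le> 0" using assms I1_pos[of r] j_pos by (simp add: mult_nonpos_nonneg)
  then have "0 < J1 r * I0 r" using assms(3) by (simp add: N_def)
  then show ?thesis using I0_pos[of r] by (simp add: zero_less_mult_iff)
qed

lemma J0_neg:
  assumes "j < r" and Npos: "\<And>x. j < x \<Longrightarrow> x < r \<Longrightarrow> 0 < N x"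
  shows "J0 r < 0"
proof -
  have nonpos: "J0 x \<le> 0" if x: "j < x" "x \<le> r" for x
  proof -
    have J1j: "0 < J1 j" using J1_pos_j j_pos by simp
    text \<open>If \<open>J0\<close> were positive somewhere, the supremum of the earlier points with
      \<open>J0 \<le> 0\<close> would be a zero at which \<open>J0' = - J1 < 0\<close>.\<close>
    show ?thesis
    proof (rule ccontr)
      assume "\<not> J0 x \<le> 0"
      then have pos: "0 < J0 x" by simp
      \<comment> \<open>Reflection turns the first zero after -x into the last zero of
        \<open>J0\<close> before x.\<close>
      have "continuous_on {- x..- j} (\<lambda>t. J0 (- t))"
        by (intro continuous_on_compose2[OF continuous_on_J0] continuous_intros) auto
      then obtain t where t: "- x < t" "t \<le> - j" "J0 (- t) = 0"
          "\<And>s. - x \<le> s \<Longrightarrow> s < t \<Longrightarrow> 0 < J0 (- s)"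
        using first_zero[of "- x" "- j" "\<lambda>t. J0 (- t)"] pos J0_j x by auto
      define z where "z = - t"
      have z: "j \<le> z" "z < x" "J0 z = 0" using t by (auto simp: z_def)
      have above: "0 < J0 s" if "z < s" "s \<le> x" for s
        using t(4)[of "- s"] that by (simp add: z_def)
      have "0 < J1 z"
        using J1j J1_pos_beyond_j[of z] z x Npos[of z] by (cases "z = j") auto
      then obtain e where e: "0 < e" "\<And>h. 0 < h \<Longrightarrow> h < e \<Longrightarrow> J0 (z + h) < J0 z"
        using DERIV_neg_dec_right[OF DERIV_J0[of z]] by auto
      define h where "h = min (e / 2) (x - z)"
      have "0 < h" "h < e" "z + h \<le> x" using e z by (auto simp: h_def)
      then show False using e(2)[of h] above[of "z + h"] z by simp
    qed
  qed
  have "J0 r < J0 j"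
  proof (rule DERIV_neg_imp_decreasing_open[of j r J0])
    fix x assume "j < x" "x < r"
    then show "\<exists>y. (J0 has_real_derivative y) (at x) \<and> y < 0"
      using DERIV_J0[of x] J1_pos_beyond_j[of x] nonpos[of x] Npos[of x]
      by (intro exI[of _ "- J1 x"]) simp
  qed (use \<open>j < r\<close> continuous_on_J0 in auto)
  then show ?thesis by (simp add: J0_j)
qed

text \<open>Beyond \<open>j\<close> the function \<open>v = - 1 / P\<close> solves \<open>v' = 1 + v\<^sup>2 + (d - 1) v / r\<close> with
  \<open>v j = 0\<close>, and the linear fractional \<open>p\<close> below is a subsolution reaching \<open>3\<close> at
  \<open>r = j (1 + 2 / d)\<close>; there \<open>Q \<ge> 1 / 3\<close>.\<close>

lemma N_has_zero: "\<exists>r>j. r \<le> j * (1 + 2 / real d) \<and> N r \<le> 0"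
proof (rule ccontr)
  define R where "R = j * (1 + 2 / real d)"
  assume "\<not> ?thesis"
  then have Npos: "0 < N r" if "j < r" "r \<le> R" for r using that by (force simp: R_def)
  define D where "D = real d"
  have D: "4 \<le> D" using real_d_ge_4 by (simp add: D_def)
  have jR: "j < R" using j_pos D by (simp add: R_def D_def field_simps)
  have neg: "J0 r < 0" if "j < r" "r \<le> R" for r using J0_neg[of r] that Npos by simp
  have J1: "0 < J1 r" if "j < r" "r \<le> R" for r
    using J1_pos_beyond_j[of r] Npos[of r] neg[of r] that by simp
  \<comment> \<open>Here \<open>\<sigma>\<close> maps [j, R] onto [0, 1] and T = 2j/D is its inverse
    slope. The constants are lower bounds: A <= T by \<open>j_ge\<close>, and 2B <= T (D - 1)/x for
    x <= R.\<close>
  define A where "A = (D + 2) / D"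
  define B where "B = (D - 1) / (D + 2)"
  define \<sigma> where "\<sigma> r = (r - j) * (D / (2 * j))" for r
  define p where "p r = A * \<sigma> r / (1 - B * \<sigma> r)" for r
  define p' where "p' r = A * (D / (2 * j)) / (1 - B * \<sigma> r)\<^sup>2" for r
  have AB: "0 < B" "B < 1" "B < A" "0 < A" using D by (auto simp: A_def B_def field_simps)
  have \<sigma>R: "\<sigma> R = 1" using j_pos D by (simp add: \<sigma>_def R_def D_def field_simps)
  have \<sigma>: "0 \<le> \<sigma> r \<and> \<sigma> r \<le> 1" if "j \<le> r" "r \<le> R" for r
  proof -
    have "\<sigma> r \<le> \<sigma> R" unfolding \<sigma>_def using that D j_pos by (intro mult_right_mono) auto
    moreover have "0 \<le> \<sigma> r" unfolding \<sigma>_def using that D j_pos by simp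
    ultimately show ?thesis using \<sigma>R by simp
  qed
  have q: "1 - B \<le> 1 - B * \<sigma> r" if "j \<le> r" "r \<le> R" for r
    using \<sigma>[OF that] AB by (simp add: mult_left_le)
  have "0 \<le> - J0 R - p R * J1 R"
  proof (rule nonneg_if_deriv_ge_linear[where a = j and b = R and M = "A / (1 - B)"
        and w = "\<lambda>r. - J0 r - p r * J1 r"
        and w' = "\<lambda>x. J1 x - (p' x * J1 x + p x * (J0 x - (D - 1) / x * J1 x))"])
    show "continuous_on {j..R} (\<lambda>r. - J0 r - p r * J1 r)"
    proof -
      have "continuous_on {j..R} \<sigma>" unfolding \<sigma>_def[abs_def] by (intro continuous_intros)
      moreover have "\<forall>x\<in>{j..R}. 1 - B * \<sigma> x \<noteq> 0" using q AB by (smt (verit) atLeastAtMost_iff)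
      ultimately show ?thesis unfolding p_def[abs_def] by (intro continuous_intros)
    qed
    show "j \<le> R" using jR by simp
    show "0 \<le> - J0 j - p j * J1 j" by (simp add: J0_j p_def \<sigma>_def)
    fix x assume x: "j < x" "x < R"
    have x0: "0 < x" using x j_pos by simp
    have q0: "0 < 1 - B * \<sigma> x" using q[of x] x AB by linarith
    have s: "0 \<le> \<sigma> x" "\<sigma> x \<le> 1" using \<sigma>[of x] x by auto
    have d\<sigma>: "(\<sigma> has_real_derivative D / (2 * j)) (at x)"
      unfolding \<sigma>_def[abs_def] using j_pos by (auto intro!: derivative_eq_intros)
    have p: "(p has_real_derivative p' x) (at x)"
    proof -
      have "((\<lambda>r. A * \<sigma> r) has_real_derivative A * (D / (2 * j))) (at x)"
        by (intro DERIV_cmult d\<sigma>)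
      moreover have "((\<lambda>r. 1 - B * \<sigma> r) has_real_derivative 0 - B * (D / (2 * j))) (at x)"
        by (intro DERIV_diff DERIV_const DERIV_cmult d\<sigma>)
      ultimately have "(p has_real_derivative
          (A * (D / (2 * j)) * (1 - B * \<sigma> x) - A * \<sigma> x * (0 - B * (D / (2 * j))))
            / ((1 - B * \<sigma> x) * (1 - B * \<sigma> x))) (at x)"
        unfolding p_def[abs_def] using q0 by (intro DERIV_divide) auto
      moreover have "A * (D / (2 * j)) * (1 - B * \<sigma> x) - A * \<sigma> x * (0 - B * (D / (2 * j)))
          = A * (D / (2 * j))"
        by algebra
      ultimately show ?thesis by (simp only: p'_def power2_eq_square)
    qed
    show "((\<lambda>r. - J0 r - p r * J1 r) has_real_derivative
        J1 x - (p' x * J1 x + p x * (J0 x - (D - 1) / x * J1 x))) (at x)"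
      unfolding D_def
      by (rule derivative_eq_intros DERIV_J0 DERIV_J1 x0 p refl)+ simp
    assume neg': "- J0 x - p x * J1 x < 0"
    have p0: "0 \<le> p x" using s AB q0 by (simp add: p_def)
    \<comment> \<open>In the equation of \<open>w = - J0 - p * J1\<close> the coefficient of
      \<open>w\<close> is \<open>p\<close>, bounded by its value at
      \<open>\<sigma> = 1\<close>.\<close>
    have pM: "p x \<le> A / (1 - B)"
      unfolding p_def using q[of x] x s AB by (intro frac_le) (auto simp: mult_left_le)
    have "p' x \<le> 1 + (p x)\<^sup>2 + (D - 1) / x * p x"
    proof -
      define T where "T = 2 * j / D"
      have T: "A \<le> T" "0 < T" using j_ge D j_pos by (auto simp: T_def A_def D_def divide_right_mono)
      have "T * p' x = A / (1 - B * \<sigma> x)\<^sup>2"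
        using D j_pos by (simp add: T_def p'_def)
      \<comment> \<open>In the variable \<open>\<sigma>\<close>, p solves dp/d\<sigma> = A + 2 B p +
        (B^2 / A) p^2, and B < A allows the quadratic coefficient to be raised to A.\<close>
      also have "\<dots> \<le> A * (1 + (p x)\<^sup>2) + 2 * B * p x"
      proof -
        have "A * (1 + (p x)\<^sup>2) + 2 * B * p x - A / (1 - B * \<sigma> x)\<^sup>2
            = A * (A\<^sup>2 - B\<^sup>2) * (\<sigma> x)\<^sup>2 / (1 - B * \<sigma> x)\<^sup>2"
        proof -
          define q where "q = 1 - B * \<sigma> x"
          have "A * (1 + (A * \<sigma> x / q)\<^sup>2) + 2 * B * (A * \<sigma> x / q) - A / q\<^sup>2
              = (A * q\<^sup>2 + A * (A * \<sigma> x)\<^sup>2 + 2 * B * A * \<sigma> x * q - A) / q\<^sup>2"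
            using q0 unfolding q_def[symmetric]
            by (simp add: diff_divide_distrib add_divide_distrib distrib_left power_divide power2_eq_square)
          also have "A * q\<^sup>2 + A * (A * \<sigma> x)\<^sup>2 + 2 * B * A * \<sigma> x * q - A = A * (A\<^sup>2 - B\<^sup>2) * (\<sigma> x)\<^sup>2"
            unfolding q_def by algebra
          finally show ?thesis unfolding p_def q_def .
        qed
        moreover have "0 \<le> A\<^sup>2 - B\<^sup>2" using AB by (simp add: power_mono)
        ultimately show ?thesis using AB by (smt (verit) divide_nonneg_nonneg mult_nonneg_nonneg zero_le_power2)
      qed
      also have "\<dots> \<le> T * (1 + (p x)\<^sup>2) + T * ((D - 1) / x) * p x"
      proof (intro add_mono mult_right_mono T p0)
        have "x \<le> j * (1 + 2 / D)" using x by (simp add: R_def D_def)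
        then have "x * D \<le> j * (D + 2)" using D by (simp add: field_simps)
        then have "1 / (D + 2) \<le> j / (x * D)" using x0 D by (simp add: divide_simps)
        then have "2 * (D - 1) * (1 / (D + 2)) \<le> 2 * (D - 1) * (j / (x * D))"
          using D by (intro mult_left_mono) auto
        then show "2 * B \<le> T * ((D - 1) / x)" by (simp add: B_def T_def mult_ac)
      qed simp
      finally have "T * p' x \<le> T * (1 + (p x)\<^sup>2 + (D - 1) / x * p x)" by (simp add: algebra_simps)
      then show ?thesis using T by simp
    qed
    then have 1: "0 \<le> J1 x * (1 + (p x)\<^sup>2 + (D - 1) / x * p x - p' x)" using J1[of x] x by simp
    have 2: "0 \<le> (A / (1 - B) - p x) * (- (- J0 x - p x * J1 x))"
      using neg' pM by (intro mult_nonneg_nonneg) auto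
    show "A / (1 - B) * (- J0 x - p x * J1 x)
        \<le> J1 x - (p' x * J1 x + p x * (J0 x - (D - 1) / x * J1 x))"
      using 1 2 by (simp add: algebra_simps power2_eq_square)
  qed
  moreover have "3 \<le> p R"
  proof -
    \<comment> \<open>The excess over 3 has numerator (D - 1)(D - 4), so d >= 4 is used here, with
      equality at d = 4.\<close>
    have "p R = (D + 2)\<^sup>2 / (3 * D)"
      using D by (simp add: p_def \<sigma>R A_def B_def divide_simps) (simp add: power2_eq_square)
    moreover have "0 \<le> (D - 1) * (D - 4)" using D by (intro mult_nonneg_nonneg) auto
    then have "3 * (3 * D) \<le> (D + 2)\<^sup>2" by (simp add: power2_eq_square algebra_simps)
    ultimately show ?thesis using D by (simp add: pos_le_divide_eq)
  qed
  then have "3 * J1 R \<le> p R * J1 R" using J1[of R] jR by (intro mult_right_mono) auto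
  ultimately have le: "J0 R \<le> - (3 * J1 R)" by linarith
  \<comment> \<open>At r = D/2 the lower bound r/(r + D) for Q equals 1/3, which matches P >= -1/3
    at R and yields \<open>N R \<le> 0\<close>.\<close>
  have "D / 2 \<le> R" using j_ge jR by (simp add: D_def)
  then have "1 / 3 \<le> R / (R + D)" using D by (simp add: divide_simps)
  also have "\<dots> \<le> Q R" using Q_ge[of R] j_pos jR by (simp add: D_def)
  finally have "I0 R \<le> 3 * I1 R" using I0_pos[of R] by (simp add: Q_def field_simps)
  then have "J1 R * I0 R \<le> J1 R * (3 * I1 R)" using J1[of R] jR by (intro mult_left_mono) auto
  moreover have "J0 R * I1 R \<le> - (3 * J1 R) * I1 R"
    using I1_pos[of R] j_pos jR by (intro mult_right_mono le) auto
  ultimately have "N R \<le> 0" by (simp add: N_def)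
  then show False using Npos[of R] jR by simp
qed

abbreviation k :: real where "k \<equiv> kzero d"

lemma kzero_props:
  "j < k \<and> k \<le> j * (1 + 2 / real d) \<and> N k = 0 \<and> (\<forall>r. j \<le> r \<longrightarrow> r < k \<longrightarrow> 0 < N r)"
proof -
  obtain b where b: "j < b" "b \<le> j * (1 + 2 / real d)" "N b \<le> 0" using N_has_zero by blast
  obtain z where z: "j < z" "z \<le> b" "N z = 0" "\<And>r. j \<le> r \<Longrightarrow> r < z \<Longrightarrow> 0 < N r"
    using first_zero[of j b N] b N_j continuous_on_N by (metis less_imp_le)
  have neg: "J0 r < 0" if "j < r" "r \<le> z" for r using J0_neg[of r] z that by simp
  have "k = z"
    unfolding kzero_def
  proof (rule cInf_eq_minimum)
    show "z \<in> {r. 0 < r \<and> fnu d r = 0}"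
      using z neg[of z] j_pos by (simp add: fnu_eq P_plus_Q_eq)
    fix x assume "x \<in> {r. 0 < r \<and> fnu d r = 0}"
    then have x: "0 < x" "P x + Q x = 0" by (auto simp: fnu_eq)
    show "z \<le> x"
    proof (rule ccontr)
      assume "\<not> z \<le> x"
      consider "x < j" | "x = j" | "j < x" by linarith
      then show False
      proof cases
        case 1
        then show ?thesis using P_pos[of x] Q_pos[of x] x by simp
      next
        case 2
        \<comment> \<open>Division by zero gives \<open>P j = 0\<close>, so f_nu takes a positive
          value at its pole and j does not count as a zero.\<close>
        then show ?thesis using Q_pos[of x] x by (simp add: P_def J0_j)
      next
        case 3
        then have "J0 x \<noteq> 0" "0 < N x" using neg[of x] z(4)[of x] \<open>\<not> z \<le> x\<close> by auto
        then show ?thesis using x I0_pos[of x] by (simp add: P_plus_Q_eq)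
      qed
    qed
  qed
  then show ?thesis using z b by simp
qed

lemma j_less_k: "j < k" and k_le: "k \<le> j * (1 + 2 / real d)" and N_k: "N k = 0"
  and N_pos: "j \<le> r \<Longrightarrow> r < k \<Longrightarrow> 0 < N r"
  using kzero_props by auto

lemma k_pos: "0 < k" using j_pos j_less_k by simp

lemma J0_neg_k: "j < r \<Longrightarrow> r \<le> k \<Longrightarrow> J0 r < 0"
  by (rule J0_neg) (auto intro: N_pos)

lemma P_plus_Q_nonpos: "j < r \<Longrightarrow> r \<le> k \<Longrightarrow> P r + Q r \<le> 0"
  using J0_neg_k[of r] N_pos[of r] N_k I0_pos[of r]
  by (cases "r = k") (auto simp: P_plus_Q_eq divide_le_0_iff mult_le_0_iff)

lemma fnu_k: "fnu d k = 0"
  using J0_neg_k[of k] j_less_k k_pos N_k by (simp add: fnu_eq P_plus_Q_eq)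

text \<open>Since j/k >= d/(d + 2) and 2/(d + 2) + d/(d + 2) = 1, it is enough that (1 + 2/d)^d < d
  + 2. The inequality is what separates a_I from a_S.\<close>

lemma jk_bound: "1 < 2 * (j / k) ^ d + j / k"
proof -
  define D where "D = real d"
  have D: "4 \<le> D" using real_d_ge_4 by (simp add: D_def)
  have lt: "(1 + 2 / D) ^ d < D + 2"
  proof -
    \<comment> \<open>From d = 6 on the power is at most e^2 < 8; the two smaller dimensions are
      computed.\<close>
    consider "d = 4" | "d = 5" | "6 \<le> d" using d_ge_4 by linarith
    then show ?thesis
    proof cases
      case 3
      have "(1 + 2 / D) ^ d \<le> exp (2 / D) ^ d"
        using D by (intro power_mono exp_ge_add_one_self) auto
      also have "\<dots> = exp 2" using D by (simp add: exp_of_nat_mult[symmetric] D_def)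
      also have "exp 2 = exp 1 * exp (1 :: real)" by (simp add: exp_add[symmetric])
      also have "\<dots> < 2.8 * 2.8" using e_less_272 by (intro mult_strict_mono) auto
      also have "\<dots> \<le> D + 2" using 3 by (simp add: D_def)
      finally show ?thesis .
    qed (simp_all add: D_def power_numeral_reduce)
  qed
  have "k / j \<le> 1 + 2 / D" using k_le j_pos by (simp add: D_def field_simps)
  then have "1 / (1 + 2 / D) \<le> 1 / (k / j)" using j_pos k_pos D by (intro divide_left_mono mult_pos_pos) (auto simp: add_pos_pos)
  then have ge: "D / (D + 2) \<le> j / k" using D by (simp add: field_simps)
  have "1 / (D + 2) < 1 / (1 + 2 / D) ^ d"
    using lt D by (intro divide_strict_left_mono) (auto simp: add_pos_pos)
  also have "\<dots> = (D / (D + 2)) ^ d"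
    using D by (simp add: power_one_over[symmetric] field_simps)
  also have "\<dots> \<le> (j / k) ^ d" using ge D by (intro power_mono) auto
  finally have "2 / (D + 2) + D / (D + 2) < 2 * (j / k) ^ d + j / k" using ge by simp
  moreover have "2 / (D + 2) + D / (D + 2) = 1" using D by (simp add: add_divide_distrib[symmetric])
  ultimately show ?thesis by simp
qed

subsection \<open>Monotonicity between the poles\<close>

lemma DERIV_fnu:
  assumes "0 < r" "J0 r \<noteq> 0"
  shows "(fnu d has_real_derivative r ^ (d - 1) * (2 + (P r)\<^sup>2 - (Q r)\<^sup>2)) (at r)"
proof -
  have "((\<lambda>r. P r + Q r) has_real_derivative
      (2 + (P r)\<^sup>2 - (Q r)\<^sup>2) - (real d - 1) / r * (P r + Q r)) (at r)"
    using DERIV_add[OF DERIV_P[OF assms] DERIV_Q[OF assms(1)]] by (simp add: algebra_simps)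
  then have "((\<lambda>r. r ^ (d - 1) * (P r + Q r)) has_real_derivative
      r ^ (d - 1) * (2 + (P r)\<^sup>2 - (Q r)\<^sup>2)) (at r)"
    by (rule DERIV_power_weight[OF assms(1)])
  then show ?thesis
    by (rule has_field_derivative_transform_within_open[where S = "{0<..}"])
      (use assms in \<open>auto simp: fnu_eq\<close>)
qed

lemma fnu_deriv_pos:
  assumes "0 < r"
  shows "0 < r ^ (d - 1) * (2 + (P r)\<^sup>2 - (Q r)\<^sup>2)"
proof -
  have "(Q r)\<^sup>2 < 1"
    using Q_pos[of r] Q_less_1[of r] assms power_strict_mono[of "Q r" 1 2] by simp
  moreover have "0 \<le> (P r)\<^sup>2" by simp
  ultimately have "0 < 2 + (P r)\<^sup>2 - (Q r)\<^sup>2" by linarith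
  then show ?thesis using assms by simp
qed

lemma continuous_on_P [continuous_intros]: "(\<And>r. r \<in> S \<Longrightarrow> J0 r \<noteq> 0) \<Longrightarrow> continuous_on S P"
  unfolding P_def[abs_def] by (intro continuous_intros) auto

lemma continuous_on_Q [continuous_intros]: "continuous_on S Q"
  unfolding Q_def[abs_def] using I0_pos by (intro continuous_intros) (metis less_irrefl)

lemma continuous_on_fnu:
  assumes "\<And>r. r \<in> S \<Longrightarrow> 0 \<le> r \<and> J0 r \<noteq> 0"
  shows "continuous_on S (fnu d)"
proof -
  have "continuous_on S (\<lambda>r. r ^ (d - 1) * (P r + Q r))"
    using assms by (intro continuous_intros) auto
  then show ?thesis using assms by (subst continuous_on_cong[OF refl fnu_eq]) auto
qed

lemma fnu_mono:
  assumes "0 \<le> r" "r \<le> s" and nz: "\<And>x. r \<le> x \<Longrightarrow> x \<le> s \<Longrightarrow> J0 x \<noteq> 0"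
  shows "fnu d r \<le> fnu d s"
proof (rule DERIV_nonneg_imp_increasing_open[of r s "fnu d"])
  fix x assume "r < x" "x < s"
  then show "\<exists>y. (fnu d has_real_derivative y) (at x) \<and> 0 \<le> y"
    using DERIV_fnu[of x] fnu_deriv_pos[of x] nz[of x] \<open>0 \<le> r\<close>
    by (intro exI[of _ "x ^ (d - 1) * (2 + (P x)\<^sup>2 - (Q x)\<^sup>2)"]) auto
next
  show "continuous_on {r..s} (fnu d)" using assms by (intro continuous_on_fnu) auto
qed fact

lemma fnu_mono_below_j: "0 \<le> r \<Longrightarrow> r \<le> s \<Longrightarrow> s < j \<Longrightarrow> fnu d r \<le> fnu d s"
proof (rule fnu_mono)
  show "J0 x \<noteq> 0" if "r \<le> x" "x \<le> s" "0 \<le> r" "s < j" for x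
    using J0_pos[of x] that by simp
qed auto

lemma fnu_mono_above_j: "j < r \<Longrightarrow> r \<le> s \<Longrightarrow> s \<le> k \<Longrightarrow> fnu d r \<le> fnu d s"
proof (rule fnu_mono)
  show "J0 x \<noteq> 0" if "r \<le> x" "x \<le> s" "j < r" "s \<le> k" for x
    using J0_neg_k[of x] that by simp
qed (use j_pos in auto)

lemma fnu_0 [simp]: "fnu d 0 = 0"
  using d_ge_4 by (simp add: fnu_eq)

lemma fnu_nonneg: "0 \<le> r \<Longrightarrow> r < j \<Longrightarrow> 0 \<le> fnu d r"
  using fnu_mono_below_j[of 0 r] by simp

lemma fnu_nonpos: "j < r \<Longrightarrow> r \<le> k \<Longrightarrow> fnu d r \<le> 0"
  using fnu_mono_above_j[of r k] fnu_k by simp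

section \<open>The product f g = P^2 - Q^2 and monotonicity below j\<close>

lemma fnu_times_gnu: "0 < r \<Longrightarrow> fnu d r * gnu d r = (P r)\<^sup>2 - (Q r)\<^sup>2"
  by (simp add: fnu_eq gnu_eq square_diff_square_factored power2_eq_square)

text \<open>With \<open>z = r\<^sup>d P'\<close>, differentiating the Riccati equation gives
  \<open>z' = r\<^bsup>d-1\<^esup> (1 + P\<^sup>2) + 2 P z\<close>; similarly for \<open>Q\<close>.\<close>

lemma P_deriv_nonneg:
  assumes "0 < r" "r < j"
  shows "0 \<le> 1 + (P r)\<^sup>2 - (real d - 1) / r * P r"
proof -
  define P' where "P' x = 1 + (P x)\<^sup>2 - (real d - 1) / x * P x" for x
  define z where "z x = x ^ d * (1 + (P x)\<^sup>2) - (real d - 1) * (x ^ (d - 1) * P x)" for x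
  have xd: "x ^ d = x * x ^ (d - 1)" for x :: real using d_ge_4 by (simp add: power_eq_if)
  have zP': "z x = x ^ d * P' x" if "0 < x" for x
    using that unfolding z_def P'_def xd by (simp add: field_simps)
  have nz: "J0 x \<noteq> 0" if "0 \<le> x" "x \<le> r" for x using J0_pos[of x] that assms by simp
  \<comment> \<open>The coefficient 2P of z is bounded on [0, r] because r stays below the
    pole.\<close>
  obtain M where M: "\<And>x. 0 \<le> x \<Longrightarrow> x \<le> r \<Longrightarrow> 2 * P x \<le> M"
  proof -
    have "continuous_on {0..r} (\<lambda>x. 2 * P x)" using nz by (intro continuous_intros) auto
    then show thesis
      using continuous_attains_sup[of "{0..r}" "\<lambda>x. 2 * P x"] that assms by fastforce
  qed
  have "0 \<le> z r"
  proof (rule nonneg_if_deriv_ge_linear[where a = 0 and b = r and M = M and w = z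
        and w' = "\<lambda>x. x ^ (d - 1) * (1 + (P x)\<^sup>2) + 2 * P x * z x"])
    show "continuous_on {0..r} z"
      unfolding z_def[abs_def] using nz by (intro continuous_intros) auto
    show "0 \<le> z 0" using d_ge_4 by (simp add: z_def power_0_left)
    fix x assume x: "0 < x" "x < r"
    have P: "(P has_real_derivative P' x) (at x)"
      unfolding P'_def using nz[of x] x by (intro DERIV_P) auto
    have "(P has_real_derivative (1 + (P x)\<^sup>2) - (real d - 1) / x * P x) (at x)"
      using P by (simp add: P'_def)
    then have w: "((\<lambda>x. x ^ (d - 1) * P x) has_real_derivative x ^ (d - 1) * (1 + (P x)\<^sup>2)) (at x)"
      using x by (intro DERIV_power_weight)
    have "(z has_real_derivative
        (real d * x ^ (d - 1) * (1 + (P x)\<^sup>2) + 2 * P x * P' x * x ^ d)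
          - (real d - 1) * (x ^ (d - 1) * (1 + (P x)\<^sup>2))) (at x)"
      unfolding z_def[abs_def]
      by (rule derivative_eq_intros P w refl)+ simp
    moreover have "(real d * x ^ (d - 1) * (1 + (P x)\<^sup>2) + 2 * P x * P' x * x ^ d)
          - (real d - 1) * (x ^ (d - 1) * (1 + (P x)\<^sup>2)) = x ^ (d - 1) * (1 + (P x)\<^sup>2) + 2 * P x * z x"
      unfolding zP'[OF x(1)] by (simp add: algebra_simps)
    ultimately show "(z has_real_derivative x ^ (d - 1) * (1 + (P x)\<^sup>2) + 2 * P x * z x) (at x)"
      by simp
    assume "z x < 0"
    then have "0 \<le> (M - 2 * P x) * - z x" using M[of x] x by (intro mult_nonneg_nonneg) auto
    moreover have "0 \<le> x ^ (d - 1) * (1 + (P x)\<^sup>2)" using x by simp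
    ultimately show "M * z x \<le> x ^ (d - 1) * (1 + (P x)\<^sup>2) + 2 * P x * z x"
      by (simp add: algebra_simps)
  qed (use assms in simp)
  then have "0 \<le> P' r" using zP'[of r] assms by (metis linorder_not_less mult_pos_neg zero_less_power)
  then show ?thesis by (simp add: P'_def)
qed

lemma Q_deriv_nonneg:
  assumes "0 < r"
  shows "0 \<le> 1 - (Q r)\<^sup>2 - (real d - 1) / r * Q r"
proof -
  define Q' where "Q' x = 1 - (Q x)\<^sup>2 - (real d - 1) / x * Q x" for x
  define z where "z x = x ^ d * (1 - (Q x)\<^sup>2) - (real d - 1) * (x ^ (d - 1) * Q x)" for x
  have xd: "x ^ d = x * x ^ (d - 1)" for x :: real using d_ge_4 by (simp add: power_eq_if)
  have zQ': "z x = x ^ d * Q' x" if "0 < x" for x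
    using that unfolding z_def Q'_def xd by (simp add: field_simps)
  have "0 \<le> z r"
  proof (rule nonneg_if_deriv_ge_linear[where a = 0 and b = r and M = 0 and w = z
        and w' = "\<lambda>x. x ^ (d - 1) * (1 - (Q x)\<^sup>2) - 2 * Q x * z x"])
    show "continuous_on {0..r} z"
      unfolding z_def[abs_def] by (intro continuous_intros)
    show "0 \<le> z 0" using d_ge_4 by (simp add: z_def power_0_left)
    fix x assume x: "0 < x" "x < r"
    have Q: "(Q has_real_derivative Q' x) (at x)"
      unfolding Q'_def using x by (intro DERIV_Q) auto
    have "(Q has_real_derivative (1 - (Q x)\<^sup>2) - (real d - 1) / x * Q x) (at x)"
      using Q by (simp add: Q'_def)
    then have w: "((\<lambda>x. x ^ (d - 1) * Q x) has_real_derivative x ^ (d - 1) * (1 - (Q x)\<^sup>2)) (at x)"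
      using x by (intro DERIV_power_weight)
    have "(z has_real_derivative
        (real d * x ^ (d - 1) * (1 - (Q x)\<^sup>2) - 2 * Q x * Q' x * x ^ d)
          - (real d - 1) * (x ^ (d - 1) * (1 - (Q x)\<^sup>2))) (at x)"
      unfolding z_def[abs_def]
      by (rule derivative_eq_intros Q w refl)+ simp
    moreover have "(real d * x ^ (d - 1) * (1 - (Q x)\<^sup>2) - 2 * Q x * Q' x * x ^ d)
          - (real d - 1) * (x ^ (d - 1) * (1 - (Q x)\<^sup>2)) = x ^ (d - 1) * (1 - (Q x)\<^sup>2) - 2 * Q x * z x"
      unfolding zQ'[OF x(1)] by (simp add: algebra_simps)
    ultimately show "(z has_real_derivative x ^ (d - 1) * (1 - (Q x)\<^sup>2) - 2 * Q x * z x) (at x)"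
      by simp
    assume "z x < 0"
    then have "0 \<le> 2 * Q x * - z x" using Q_pos[of x] x by (intro mult_nonneg_nonneg) auto
    moreover have "0 \<le> x ^ (d - 1) * (1 - (Q x)\<^sup>2)"
      using x Q_pos[of x] Q_less_1[of x] by (simp add: power_le_one)
    ultimately show "0 * z x \<le> x ^ (d - 1) * (1 - (Q x)\<^sup>2) - 2 * Q x * z x"
      by (simp add: algebra_simps)
  qed (use assms in simp)
  then have "0 \<le> Q' r" using zQ'[of r] assms by (metis linorder_not_less mult_pos_neg zero_less_power)
  then show ?thesis by (simp add: Q'_def)
qed

lemma P_mono: "0 < r \<Longrightarrow> r \<le> s \<Longrightarrow> s < j \<Longrightarrow> P r \<le> P s"
proof (rule DERIV_nonneg_imp_nondecreasing[of r s P])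
  fix x assume "0 < r" "r \<le> x" "x \<le> s" "s < j"
  then show "\<exists>y. (P has_real_derivative y) (at x) \<and> 0 \<le> y"
    using DERIV_P[of x] J0_pos[of x] P_deriv_nonneg[of x] by (intro exI conjI) auto
qed

lemma Q_mono: "0 < r \<Longrightarrow> r \<le> s \<Longrightarrow> Q r \<le> Q s"
proof (rule DERIV_nonneg_imp_nondecreasing[of r s Q])
  fix x assume "0 < r" "r \<le> x" "x \<le> s"
  then show "\<exists>y. (Q has_real_derivative y) (at x) \<and> 0 \<le> y"
    using DERIV_Q[of x] Q_deriv_nonneg[of x] by (intro exI conjI) auto
qed

lemma DERIV_P_minus_Q:
  assumes "0 < r" "J0 r \<noteq> 0"
  shows "((\<lambda>r. P r - Q r) has_real_derivative
      ((P r)\<^sup>2 + (Q r)\<^sup>2) - (real d - 1) / r * (P r - Q r)) (at r)"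
  using DERIV_diff[OF DERIV_P[OF assms] DERIV_Q[OF assms(1)]] by (simp add: algebra_simps)

text \<open>The difference starts at 0, and wherever it is negative the damping term and the source
  P^2 + Q^2 both push it upwards.\<close>

lemma Q_le_P:
  assumes "0 \<le> r" "r < j"
  shows "Q r \<le> P r"
proof -
  have nz: "J0 x \<noteq> 0" if "0 \<le> x" "x \<le> r" for x using J0_pos[of x] that assms by simp
  have "0 \<le> P r - Q r"
  proof (rule nonneg_if_deriv_ge_linear[where a = 0 and b = r and M = 0
        and w = "\<lambda>r. P r - Q r"
        and w' = "\<lambda>r. ((P r)\<^sup>2 + (Q r)\<^sup>2) - (real d - 1) / r * (P r - Q r)"])
    show "continuous_on {0..r} (\<lambda>r. P r - Q r)" using nz by (intro continuous_intros) auto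
    fix x assume x: "0 < x" "x < r"
    then show "((\<lambda>r. P r - Q r) has_real_derivative
        ((P x)\<^sup>2 + (Q x)\<^sup>2) - (real d - 1) / x * (P x - Q x)) (at x)"
      using nz[of x] by (intro DERIV_P_minus_Q) auto
    assume "P x - Q x < 0"
    then have "(real d - 1) / x * (P x - Q x) \<le> 0"
      using x real_d_ge_4 by (intro mult_nonneg_nonpos) auto
    moreover have "0 \<le> (P x)\<^sup>2 + (Q x)\<^sup>2" by simp
    ultimately show "0 * (P x - Q x) \<le> ((P x)\<^sup>2 + (Q x)\<^sup>2) - (real d - 1) / x * (P x - Q x)"
      by linarith
  qed (use assms in \<open>auto simp: P_def Q_def\<close>)
  then show ?thesis by simp
qed

lemma P_minus_Q_mono:
  assumes "0 < r" "r \<le> s" "s < j"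
  shows "P r - Q r \<le> P s - Q s"
proof -
  define S where "S x = (P x)\<^sup>2 + (Q x)\<^sup>2" for x
  text \<open>\<open>x\<^sup>d (P - Q)'\<close> is nondecreasing and vanishes at \<open>0\<close>.\<close>
  have nn: "0 \<le> S x - (real d - 1) / x * (P x - Q x)" if x: "0 < x" "x < j" for x
  proof -
    define z where "z x = x ^ d * S x - (real d - 1) * (x ^ (d - 1) * (P x - Q x))" for x
    have xd: "x ^ d = x * x ^ (d - 1)" for x :: real using d_ge_4 by (simp add: power_eq_if)
    have nz: "J0 t \<noteq> 0" if "0 \<le> t" "t \<le> x" for t using J0_pos[of t] that x by simp
    have "z 0 \<le> z x"
    proof (rule DERIV_nonneg_imp_increasing_open[of 0 x z])
      show "continuous_on {0..x} z"
        unfolding z_def[abs_def] S_def using nz by (intro continuous_intros) auto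
      fix t assume t: "0 < t" "t < x"
      define P' where "P' = 1 + (P t)\<^sup>2 - (real d - 1) / t * P t"
      define Q' where "Q' = 1 - (Q t)\<^sup>2 - (real d - 1) / t * Q t"
      have nzt: "J0 t \<noteq> 0" using nz t by simp
      have S: "(S has_real_derivative 2 * P t * P' + 2 * Q t * Q') (at t)"
        unfolding S_def[abs_def] P'_def Q'_def
        by (rule derivative_eq_intros DERIV_P DERIV_Q t nzt refl)+ simp
      have w: "((\<lambda>t. t ^ (d - 1) * (P t - Q t)) has_real_derivative t ^ (d - 1) * S t) (at t)"
        unfolding S_def by (intro DERIV_power_weight DERIV_P_minus_Q t nzt)
      have "(z has_real_derivative
          (real d * t ^ (d - 1) * S t + (2 * P t * P' + 2 * Q t * Q') * t ^ d)
            - (real d - 1) * (t ^ (d - 1) * S t)) (at t)"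
        unfolding z_def[abs_def]
        by (rule derivative_eq_intros S w refl)+ simp
      moreover have "(real d * t ^ (d - 1) * S t + (2 * P t * P' + 2 * Q t * Q') * t ^ d)
            - (real d - 1) * (t ^ (d - 1) * S t)
          = t ^ (d - 1) * S t + (2 * P t * P' + 2 * Q t * Q') * t ^ d"
        by (simp add: algebra_simps)
      moreover have "0 \<le> t ^ (d - 1) * S t + (2 * P t * P' + 2 * Q t * Q') * t ^ d"
      proof -
        have "0 \<le> P'" "0 \<le> Q'" "0 \<le> P t" "0 \<le> Q t"
          using P_deriv_nonneg[of t] Q_deriv_nonneg[of t] P_pos[of t] Q_pos[of t] t x
          by (auto simp: P'_def Q'_def)
        then show ?thesis using t by (simp add: S_def)
      qed
      ultimately show "\<exists>y. (z has_real_derivative y) (at t) \<and> 0 \<le> y" by metis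
    qed (use x in simp)
    moreover have "z 0 = 0" using d_ge_4 by (simp add: z_def power_0_left)
    moreover have "z x = x ^ d * (S x - (real d - 1) / x * (P x - Q x))"
      using x unfolding z_def xd by (simp add: field_simps)
    ultimately have "x ^ d * 0 \<le> x ^ d * (S x - (real d - 1) / x * (P x - Q x))" by simp
    then show ?thesis using zero_less_power[OF x(1)] by (rule mult_left_le_imp_le)
  qed
  show ?thesis
  proof (rule DERIV_nonneg_imp_nondecreasing[of r s "\<lambda>r. P r - Q r"])
    fix x assume "r \<le> x" "x \<le> s"
    then show "\<exists>y. ((\<lambda>r. P r - Q r) has_real_derivative y) (at x) \<and> 0 \<le> y"
      using DERIV_P_minus_Q[of x] nn[of x] J0_pos[of x] assms unfolding S_def
      by (intro exI conjI) auto
  qed fact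
qed

text \<open>The factors P - Q and P + Q are both nonnegative and nondecreasing.\<close>

lemma P2_minus_Q2_mono:
  assumes "0 < r" "r \<le> s" "s < j"
  shows "(P r)\<^sup>2 - (Q r)\<^sup>2 \<le> (P s)\<^sup>2 - (Q s)\<^sup>2"
proof -
  have "(P r - Q r) * (P r + Q r) \<le> (P s - Q s) * (P s + Q s)"
  proof (rule mult_mono)
    show "P r + Q r \<le> P s + Q s" using P_mono Q_mono assms by (simp add: add_mono)
    show "0 \<le> P s - Q s" using Q_le_P[of s] assms by simp
    show "0 \<le> P r + Q r" using P_pos[of r] Q_pos[of r] assms by simp
  qed (rule P_minus_Q_mono[OF assms])
  then show ?thesis by (simp add: power2_eq_square algebra_simps)
qed

text \<open>Below j the inequality Q <= P gives f' >= 2 r^(d-1). This lower bound cancels the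
  leading terms in the derivative of F / K^d.\<close>

lemma fnu_ge:
  assumes "0 \<le> r" "r < j"
  shows "2 * r ^ d / real d \<le> fnu d r"
proof -
  define w where "w r = fnu d r - 2 * r ^ d / real d" for r
  have nz: "J0 t \<noteq> 0" if "0 \<le> t" "t \<le> r" for t using J0_pos[of t] that assms by simp
  have dpos: "0 < real d" using real_d_ge_4 by simp
  have "w 0 \<le> w r"
  proof (rule DERIV_nonneg_imp_increasing_open[of 0 r w])
    show "continuous_on {0..r} w"
      unfolding w_def[abs_def] using nz dpos by (intro continuous_intros continuous_on_fnu) auto
    fix t assume t: "0 < t" "t < r"
    have "(w has_real_derivative t ^ (d - 1) * (2 + (P t)\<^sup>2 - (Q t)\<^sup>2) - 2 * t ^ (d - 1)) (at t)"
    proof -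
      have "((\<lambda>r. 2 * r ^ d / real d) has_real_derivative 2 * t ^ (d - 1)) (at t)"
        using dpos by (auto intro!: derivative_eq_intros)
      then show ?thesis
        unfolding w_def[abs_def] using t nz by (intro DERIV_diff DERIV_fnu) auto
    qed
    moreover have "(Q t)\<^sup>2 \<le> (P t)\<^sup>2"
      using Q_le_P[of t] Q_pos[of t] t assms by (intro power_mono) auto
    then have "0 \<le> t ^ (d - 1) * (2 + (P t)\<^sup>2 - (Q t)\<^sup>2) - 2 * t ^ (d - 1)"
      using t by (simp add: algebra_simps mult_left_mono)
    ultimately show "\<exists>y. (w has_real_derivative y) (at t) \<and> 0 \<le> y" by blast
  qed fact
  then show ?thesis using d_ge_4 by (simp add: w_def power_0_left)
qed

section \<open>Signs and monotonicity between j and k\<close>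

lemma P_neg: "j < r \<Longrightarrow> r \<le> k \<Longrightarrow> P r < 0"
  using P_plus_Q_nonpos[of r] Q_pos[of r] j_pos by simp

lemma Q2_le_P2: "j < r \<Longrightarrow> r \<le> k \<Longrightarrow> (Q r)\<^sup>2 \<le> (P r)\<^sup>2"
  using P_plus_Q_nonpos[of r] Q_pos[of r] j_pos by (simp add: abs_le_square_iff[symmetric])

lemma gnu_neg: "j < r \<Longrightarrow> r \<le> k \<Longrightarrow> gnu d r < 0"
  using P_neg[of r] Q_pos[of r] j_pos by (simp add: gnu_eq divide_neg_pos)

text \<open>Past j the difference P - Q is negative, so its damping term helps it increase; dividing
  a negative number by the larger power then raises it further.\<close>

lemma gnu_mono:
  assumes "j < r" "r \<le> s" "s \<le> k"
  shows "gnu d r \<le> gnu d s"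
proof -
  have r0: "0 < r" using assms j_pos by simp
  have "P r - Q r \<le> P s - Q s"
  proof (rule DERIV_nonneg_imp_nondecreasing[of r s "\<lambda>r. P r - Q r"])
    fix x assume x: "r \<le> x" "x \<le> s"
    have "J0 x \<noteq> 0" using J0_neg_k[of x] x assms by simp
    moreover have "(real d - 1) / x * (P x - Q x) \<le> 0"
      using P_neg[of x] Q_pos[of x] x assms r0 real_d_ge_4 by (intro mult_nonneg_nonpos) auto
    moreover have "0 \<le> (P x)\<^sup>2 + (Q x)\<^sup>2" by simp
    ultimately show "\<exists>y. ((\<lambda>r. P r - Q r) has_real_derivative y) (at x) \<and> 0 \<le> y"
      using DERIV_P_minus_Q[of x] x r0
      by (intro exI[of _ "((P x)\<^sup>2 + (Q x)\<^sup>2) - (real d - 1) / x * (P x - Q x)"] conjI) linarith+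
  qed fact
  then have "(P r - Q r) / r ^ (d - 1) \<le> (P s - Q s) / r ^ (d - 1)"
    using r0 by (intro divide_right_mono) auto
  also have "\<dots> \<le> (P s - Q s) / s ^ (d - 1)"
    using P_neg[of s] Q_pos[of s] r0 assms
    by (intro divide_left_mono_neg power_mono mult_pos_pos) auto
  finally show ?thesis using r0 assms by (simp add: gnu_eq)
qed

subsection \<open>The functions b and K\<close>

abbreviation b :: "real \<Rightarrow> real" where "b \<equiv> bfun d"
abbreviation K :: "real \<Rightarrow> real" where "K \<equiv> Kfun d"

lemma power_d: "x ^ d = x * x ^ (d - 1)" for x :: real
  using d_ge_4 by (simp add: power_eq_if)

lemma b_power: "0 \<le> a \<Longrightarrow> a \<le> 1 \<Longrightarrow> b a ^ d = 1 - a ^ d"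
  using d_ge_4 by (simp add: bfun_def power_le_one)

lemma b_nonneg: "0 \<le> a \<Longrightarrow> a \<le> 1 \<Longrightarrow> 0 \<le> b a"
  using d_ge_4 by (simp add: bfun_def power_le_one)

lemma b_0 [simp]: "b 0 = 1" and b_1 [simp]: "b 1 = 0"
  using d_ge_4 by (simp_all add: bfun_def power_0_left)

lemma b_strict_antimono: "0 \<le> a \<Longrightarrow> a < a' \<Longrightarrow> b a' < b a"
  using d_ge_4 by (simp add: bfun_def power_strict_mono)

lemma b_antimono: "0 \<le> a \<Longrightarrow> a \<le> a' \<Longrightarrow> b a' \<le> b a"
  using b_strict_antimono[of a a'] by (cases "a = a'") auto

lemma b_pos: "0 \<le> a \<Longrightarrow> a < 1 \<Longrightarrow> 0 < b a"
  using b_strict_antimono[of a 1] by simp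

lemma b_le_1: "0 \<le> a \<Longrightarrow> b a \<le> 1"
  using b_antimono[of 0 a] by simp

lemma continuous_on_b [continuous_intros]: "continuous_on S b"
  unfolding bfun_def[abs_def] by (intro continuous_intros)

lemma DERIV_b:
  assumes "0 < a" "a < 1"
  shows "(b has_real_derivative - ((a / b a) ^ (d - 1))) (at a)"
proof -
  have "0 < 1 - a ^ d" using assms d_ge_4 by (simp add: power_less_one_iff)
  then have "(root d has_real_derivative inverse (real d * root d (1 - a ^ d) ^ (d - Suc 0))) (at (1 - a ^ d))"
    using d_ge_4 by (intro DERIV_real_root) auto
  moreover have "((\<lambda>a. 1 - a ^ d) has_real_derivative - (real d * a ^ (d - 1))) (at a)"
    by (auto intro!: derivative_eq_intros)
  ultimately have "(b has_real_derivative
      inverse (real d * root d (1 - a ^ d) ^ (d - Suc 0)) * - (real d * a ^ (d - 1))) (at a)"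
    unfolding bfun_def[abs_def] by (rule DERIV_chain2)
  moreover have "inverse (real d * root d (1 - a ^ d) ^ (d - Suc 0)) * - (real d * a ^ (d - 1))
      = - ((a / b a) ^ (d - 1))"
    using real_d_ge_4 b_pos[of a] assms by (simp add: bfun_def[symmetric] power_divide field_simps)
  ultimately show ?thesis by simp
qed

lemma one_plus_b_power_ge: "0 \<le> a \<Longrightarrow> a \<le> 1 \<Longrightarrow> 1 \<le> 1 + b a ^ (d - 1)"
  using b_nonneg by simp

lemma continuous_on_K [continuous_intros]:
  assumes "S \<subseteq> {0..1}"
  shows "continuous_on S K"
proof -
  have "1 + b a ^ (d - 1) \<noteq> 0" if "a \<in> S" for a
    using one_plus_b_power_ge[of a] that assms by force
  then show ?thesis unfolding Kfun_def[abs_def] by (intro continuous_intros) auto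
qed

lemma K_0 [simp]: "K 0 = 0" and K_1 [simp]: "K 1 = 1"
  using d_ge_4 by (simp_all add: Kfun_def power_0_left)

lemma K_pos: "0 < a \<Longrightarrow> a \<le> 1 \<Longrightarrow> 0 < K a"
  using one_plus_b_power_ge[of a] by (simp add: Kfun_def)

lemma K_mono: "0 \<le> a \<Longrightarrow> a \<le> a' \<Longrightarrow> a' \<le> 1 \<Longrightarrow> K a \<le> K a'"
  unfolding Kfun_def using one_plus_b_power_ge[of a'] b_nonneg[of a']
  by (intro frac_le add_mono power_mono b_antimono add_pos_nonneg) auto

lemma K_nonneg: "0 \<le> a \<Longrightarrow> a \<le> 1 \<Longrightarrow> 0 \<le> K a"
  using K_mono[of 0 a] by simp

lemma K_le_1: "0 \<le> a \<Longrightarrow> a \<le> 1 \<Longrightarrow> K a \<le> 1"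
  using K_mono[of a 1] by simp

lemma aK_mono: "0 \<le> a \<Longrightarrow> a \<le> a' \<Longrightarrow> a' \<le> 1 \<Longrightarrow> a * K a \<le> a' * K a'"
  by (intro mult_mono K_mono K_nonneg) auto

lemma aK_strict_mono:
  assumes "0 \<le> a" "a < a'" "a' \<le> 1"
  shows "a * K a < a' * K a'"
proof -
  have "a * K a \<le> a * K a'" using assms by (intro mult_left_mono K_mono) auto
  also have "\<dots> < a' * K a'" using assms K_pos[of a'] by (intro mult_strict_right_mono) auto
  finally show ?thesis .
qed

text \<open>The logarithmic derivative a K'(a) / K(a) in explicit form, from which its monotonicity
  can be read off.\<close>

definition kappa :: "real \<Rightarrow> real" where
  "kappa a = (real d - 1) * (1 + a ^ d / (b a * (1 + b a ^ (d - 1))))"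

lemma DERIV_K:
  assumes a: "0 < a" "a < 1"
  shows "(K has_real_derivative K a * kappa a / a) (at a)"
proof -
  define B where "B = 1 + b a ^ (d - 1)"
  have B: "1 \<le> B" using one_plus_b_power_ge[of a] a by (simp add: B_def)
  have b0: "0 < b a" using b_pos a by simp
  have pow: "x ^ (d - 1) = x * x ^ (d - 2)" for x :: real
    using d_ge_4 by (simp add: power_eq_if numeral_2_eq_2)
  have d1: "real (d - 1) = real d - 1" "d - 1 - Suc 0 = d - 2" using d_ge_4 by (auto simp: of_nat_diff)
  have "((\<lambda>a. a ^ (d - 1)) has_real_derivative (real d - 1) * a ^ (d - 2)) (at a)"
    using DERIV_pow[of "d - 1" a] by (simp only: d1)
  moreover have "((\<lambda>a. 1 + b a ^ (d - 1)) has_real_derivative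
      0 + (real d - 1) * (b a ^ (d - 2) * - ((a / b a) ^ (d - 1)))) (at a)"
    using DERIV_power[OF DERIV_b[OF a], of "d - 1"]
    by (intro DERIV_add DERIV_const) (simp only: d1 mult_ac)
  ultimately have "(K has_real_derivative
      ((real d - 1) * a ^ (d - 2) * B
        - a ^ (d - 1) * (0 + (real d - 1) * (b a ^ (d - 2) * - ((a / b a) ^ (d - 1))))) / (B * B)) (at a)"
    unfolding Kfun_def[abs_def] B_def using B unfolding B_def by (intro DERIV_divide) auto
  moreover have "b a ^ (d - 2) * (a / b a) ^ (d - 1) = a ^ (d - 1) / b a"
    unfolding power_divide pow[of "b a"] using b0 by simp
  then have "((real d - 1) * a ^ (d - 2) * B
        - a ^ (d - 1) * (0 + (real d - 1) * (b a ^ (d - 2) * - ((a / b a) ^ (d - 1))))) / (B * B)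
      = ((real d - 1) * a ^ (d - 2) * B + a ^ (d - 1) * ((real d - 1) * (a ^ (d - 1) / b a))) / (B * B)"
    by simp
  moreover have "\<dots> = K a * kappa a / a"
  proof -
    have "(c * A * B + a * A * (c * (a * A / \<beta>))) / (B * B)
        = (a * A / B) * (c * (1 + a * (a * A) / (\<beta> * B))) / a"
      if "0 < \<beta>" for c A \<beta> :: real
      using that a B by (simp add: field_simps)
    from this[OF b0] show ?thesis
      unfolding Kfun_def kappa_def B_def[symmetric] power_d[of a] pow[of a] .
  qed
  ultimately show ?thesis by (simp only:)
qed

lemma Kder_eq: "0 < a \<Longrightarrow> a < 1 \<Longrightarrow> Kder d a = K a * kappa a / a"
  unfolding Kder_def by (intro DERIV_imp_deriv DERIV_K)

lemma kappa_nonneg: "0 < a \<Longrightarrow> a < 1 \<Longrightarrow> 0 \<le> kappa a"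
  using b_pos[of a] real_d_ge_4 unfolding kappa_def
  by (intro mult_nonneg_nonneg add_nonneg_nonneg divide_nonneg_nonneg) auto

lemma kappa_mono:
  assumes "0 < a" "a \<le> a'" "a' < 1"
  shows "kappa a \<le> kappa a'"
proof -
  have "0 < b a'" "b a' \<le> b a" using assms b_pos b_antimono by auto
  then show ?thesis
    unfolding kappa_def using assms real_d_ge_4
    by (intro mult_left_mono add_left_mono frac_le power_mono mult_mono)
      (auto simp: add_pos_nonneg intro!: power_mono add_nonneg_nonneg)
qed

section \<open>The points a_I and a_S, and the two arguments of f relative to j\<close>

lemma jk_ratio: "0 < j / k" "j / k < 1"
  using j_pos j_less_k by auto

text \<open>The relation a^d + b^d = 1 gives the explicit solution; strict monotonicity of
  \<open>b\<close> makes the definite description legitimate.\<close>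

lemma aI_props: "0 < aI d \<and> aI d < 1 \<and> b (aI d) = j / k"
proof -
  define a where "a = root d (1 - (j / k) ^ d)"
  have lt: "0 < (j / k) ^ d" "(j / k) ^ d < 1"
    using jk_ratio d_ge_4 by (auto simp: power_less_one_iff)
  then have a: "0 < a" "a < 1" using d_ge_4 by (auto simp: a_def)
  have "a ^ d = 1 - (j / k) ^ d" using lt d_ge_4 by (simp add: a_def)
  then have ba: "b a = j / k"
    using jk_ratio d_ge_4 by (simp add: bfun_def real_root_power_cancel)
  have "aI d = a"
    unfolding aI_def
  proof (rule the_equality)
    show "0 \<le> a \<and> a \<le> 1 \<and> b a = j / k" using a ba by simp
    fix a' assume a': "0 \<le> a' \<and> a' \<le> 1 \<and> b a' = j / k"
    show "a' = a"
      using b_strict_antimono[of a a'] b_strict_antimono[of a' a] a a' ba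
      by (cases a a' rule: linorder_cases) auto
  qed
  then show ?thesis using a ba by simp
qed

lemma aS_props: "0 < aS d \<and> aS d < 1 \<and> aS d * K (aS d) = j / k"
proof -
  have "\<exists>a\<ge>0. a \<le> 1 \<and> a * K a = j / k"
    using jk_ratio by (intro IVT') (auto intro!: continuous_intros)
  then obtain a where a: "0 \<le> a" "a \<le> 1" "a * K a = j / k" by blast
  then have "a \<noteq> 0" "a \<noteq> 1" using jk_ratio by auto
  moreover have "aS d = a"
    unfolding aS_def
  proof (rule the_equality)
    show "0 \<le> a \<and> a \<le> 1 \<and> a * K a = j / k" using a by simp
    fix a' assume a': "0 \<le> a' \<and> a' \<le> 1 \<and> a' * K a' = j / k"
    show "a' = a"
      using aK_strict_mono[of a a'] aK_strict_mono[of a' a] a a'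
      by (cases a a' rule: linorder_cases) auto
  qed
  ultimately show ?thesis using a by auto
qed

lemma aI_pos: "0 < aI d" and aI_less_1: "aI d < 1" and b_aI: "b (aI d) = j / k"
  using aI_props by auto

lemma aS_pos: "0 < aS d" and aK_aS: "aS d * K (aS d) = j / k"
  using aS_props by auto

text \<open>With q = j/k one has b = q and a^d = 1 - q^d at a_I, so clearing the denominator leaves
  1 - q^d < q + q^d, which is \<open>jk_bound\<close>.\<close>

lemma aK_aI: "aI d * K (aI d) < j / k"
proof -
  have "aI d * K (aI d) = aI d ^ d / (1 + (j / k) ^ (d - 1))"
    by (simp add: Kfun_def b_aI power_d)
  also have "\<dots> = (1 - (j / k) ^ d) / (1 + (j / k) ^ (d - 1))"
    using b_power[of "aI d"] aI_pos aI_less_1 by (simp add: b_aI)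
  also have "\<dots> < j / k"
  proof -
    have "1 - (j / k) ^ d < j / k * (1 + (j / k) ^ (d - 1))"
      using jk_bound by (simp only: distrib_left mult_1_right power_d[of "j / k", symmetric])
    moreover have "0 < 1 + (j / k) ^ (d - 1)"
      using jk_ratio by (intro add_pos_pos zero_less_power) auto
    ultimately show ?thesis by (simp only: pos_divide_less_eq)
  qed
  finally show ?thesis .
qed

lemma aI_less_aS: "aI d < aS d"
  using aK_mono[of "aS d" "aI d"] aK_aI aK_aS aS_pos aI_less_1 by linarith

text \<open>The endpoint a_I is included, since the right end of a subdivision interval may be a_I
  itself.\<close>

lemma u_less_j: "0 \<le> a \<Longrightarrow> a \<le> aI d \<Longrightarrow> k * K a * a < j"
  using aK_mono[of a "aI d"] aK_aI aI_less_1 k_pos pos_less_divide_eq[of k "a * K a" j]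
  by (simp add: mult_ac)

lemma j_less_w: "0 \<le> a \<Longrightarrow> a < aI d \<Longrightarrow> j < k * b a"
  using b_strict_antimono[of a "aI d"] b_aI k_pos by (simp add: field_simps)

lemma w_le_k: "0 \<le> a \<Longrightarrow> k * b a \<le> k"
  using b_le_1[of a] k_pos by simp

lemma j_less_u: "aS d < a \<Longrightarrow> a \<le> 1 \<Longrightarrow> j < k * K a * a"
  using aK_strict_mono[of "aS d" a] aK_aS aS_pos k_pos by (simp add: field_simps)

lemma u_le_k:
  assumes "0 \<le> a" "a \<le> 1"
  shows "k * K a * a \<le> k"
  using aK_mono[of a 1] assms k_pos by (simp add: mult_ac)

lemma w_less_j: "aS d \<le> a \<Longrightarrow> k * b a < j"
  using b_strict_antimono[of "aI d" a] b_aI aI_less_aS aI_pos k_pos by (simp add: field_simps)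

lemma u_mono: "0 \<le> a \<Longrightarrow> a \<le> a' \<Longrightarrow> a' \<le> 1 \<Longrightarrow> k * K a * a \<le> k * K a' * a'"
  using aK_mono[of a a'] k_pos by (simp add: mult_ac)

lemma w_antimono: "0 \<le> a \<Longrightarrow> a \<le> a' \<Longrightarrow> k * b a' \<le> k * b a"
  using b_antimono[of a a'] k_pos by simp

lemma DERIV_fnu_u:
  assumes a: "0 < a" "a < 1" and nz: "J0 (k * K a * a) \<noteq> 0"
  shows "((\<lambda>a. fnu d (k * K a * a)) has_real_derivative
    k ^ d * a ^ (d - 1) * K a ^ d * (1 + kappa a) * (2 + (P (k * K a * a))\<^sup>2 - (Q (k * K a * a))\<^sup>2)) (at a)"
proof -
  have "((\<lambda>a. k * K a * a) has_real_derivative k * (K a * (1 + kappa a))) (at a)"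
    by (rule derivative_eq_intros DERIV_K a refl)+ (use a in \<open>simp add: algebra_simps\<close>)
  then have "((\<lambda>a. fnu d (k * K a * a)) has_real_derivative
      (k * K a * a) ^ (d - 1) * (2 + (P (k * K a * a))\<^sup>2 - (Q (k * K a * a))\<^sup>2)
        * (k * (K a * (1 + kappa a)))) (at a)"
    using a K_pos[of a] k_pos nz by (intro DERIV_chain2[OF DERIV_fnu]) auto
  then show ?thesis by (simp add: power_d[of k] power_d[of "K a"] power_mult_distrib mult_ac)
qed

text \<open>Because a^d + b^d = 1, the product b^(d-1) b' equals -a^(d-1), so the weight in the
  derivative is free of b.\<close>

lemma DERIV_fnu_w:
  assumes a: "0 < a" "a < 1" and nz: "J0 (k * b a) \<noteq> 0"
  shows "((\<lambda>a. fnu d (k * b a)) has_real_derivative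
    - (k ^ d * a ^ (d - 1) * (2 + (P (k * b a))\<^sup>2 - (Q (k * b a))\<^sup>2))) (at a)"
proof -
  have b0: "0 < b a" using a b_pos by simp
  have "((\<lambda>a. fnu d (k * b a)) has_real_derivative
      (k * b a) ^ (d - 1) * (2 + (P (k * b a))\<^sup>2 - (Q (k * b a))\<^sup>2) * (k * - ((a / b a) ^ (d - 1)))) (at a)"
    using a b0 k_pos nz by (intro DERIV_chain2[OF DERIV_fnu] DERIV_cmult DERIV_b) auto
  moreover have "b a ^ (d - 1) * (a / b a) ^ (d - 1) = a ^ (d - 1)"
    using b0 by (simp add: power_divide)
  then have "(k * b a) ^ (d - 1) * (2 + (P (k * b a))\<^sup>2 - (Q (k * b a))\<^sup>2) * (k * - ((a / b a) ^ (d - 1)))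
      = - (k ^ d * a ^ (d - 1) * (2 + (P (k * b a))\<^sup>2 - (Q (k * b a))\<^sup>2))"
  proof -
    have "k' * B * S * (k * - X) = - (k * k' * (B * X) * S)" for k' B S X :: real by simp
    then show ?thesis
      unfolding power_d[of k] power_mult_distrib by (simp only: \<open>b a ^ (d - 1) * (a / b a) ^ (d - 1) = a ^ (d - 1)\<close>)
  qed
  ultimately show ?thesis by (simp only:)
qed

subsection \<open>The end intervals\<close>

text \<open>This is f(r) / r^d with the factor r/2 of \<open>J1\<close> and \<open>I1\<close> taken
  out, hence continuous at 0.\<close>

definition fnu_quot :: "real \<Rightarrow> real" where
  "fnu_quot r = (bessel_series (nu d + 1) (- ((r/2)\<^sup>2)) / J0 r + bessel_series (nu d + 1) ((r/2)\<^sup>2) / I0 r) / 2"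

lemma fnu_eq_quot: "0 \<le> r \<Longrightarrow> fnu d r = r ^ d * fnu_quot r"
  by (simp add: fnu_eq fnu_quot_def P_def Q_def J1_def I1_def power_d distrib_left add_divide_distrib mult_ac)

lemma continuous_on_fnu_quot:
  assumes "\<And>r. r \<in> S \<Longrightarrow> J0 r \<noteq> 0"
  shows "continuous_on S fnu_quot"
proof -
  have "I0 r \<noteq> 0" for r using I0_pos[of r] by simp
  then show ?thesis
    unfolding fnu_quot_def[abs_def] using assms nu_nonneg by (intro continuous_intros) auto
qed

text \<open>The powers in g cancel because K(a) / a^(d-1) = 1 / (1 + b^(d-1)). What remains is a
  product of nonnegative increasing factors on (0, a_I].\<close>

lemma G1_eq:
  assumes "0 < a" "a < 1"
  shows "G1 d a = (1 + kappa a) / (1 + b a ^ (d - 1)) * (P (k * K a * a) - Q (k * K a * a))"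
proof -
  have pos: "0 < K a" "0 < k" using K_pos[of a] k_pos assms by auto
  have "a * Kder d a + K a = K a * (1 + kappa a)"
    using assms by (simp add: Kder_eq algebra_simps)
  then have "G1 d a = K a * (1 + kappa a) * (k * K a) ^ (d - 1) * gnu d (k * a * K a)"
    by (simp add: G1_def)
  also have "k * a * K a = k * K a * a" by simp
  also have "gnu d (k * K a * a) = (P (k * K a * a) - Q (k * K a * a)) / ((k * K a) ^ (d - 1) * a ^ (d - 1))"
    using pos assms by (simp add: gnu_eq power_mult_distrib)
  also have "K a * (1 + kappa a) * (k * K a) ^ (d - 1)
      * ((P (k * K a * a) - Q (k * K a * a)) / ((k * K a) ^ (d - 1) * a ^ (d - 1)))
      = K a / a ^ (d - 1) * (1 + kappa a) * (P (k * K a * a) - Q (k * K a * a))"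
    using pos by simp
  also have "K a / a ^ (d - 1) = 1 / (1 + b a ^ (d - 1))"
    using assms by (simp add: Kfun_def)
  finally show ?thesis by simp
qed

lemma G1_mono:
  assumes "0 < a" "a \<le> a'" "a' \<le> aI d"
  shows "G1 d a \<le> G1 d a'"
proof -
  have lt: "a < 1" "a' < 1" using assms aI_less_1 by auto
  have u: "0 < k * K a * a" "k * K a * a \<le> k * K a' * a'" "k * K a' * a' < j"
    using K_pos[of a] k_pos u_mono[of a a'] u_less_j[of a'] assms lt by auto
  have "(1 + kappa a) / (1 + b a ^ (d - 1)) * (P (k * K a * a) - Q (k * K a * a))
      \<le> (1 + kappa a') / (1 + b a' ^ (d - 1)) * (P (k * K a' * a') - Q (k * K a' * a'))"
  proof (rule mult_mono)
    show "(1 + kappa a) / (1 + b a ^ (d - 1)) \<le> (1 + kappa a') / (1 + b a' ^ (d - 1))"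
      using assms lt kappa_mono[of a a'] kappa_nonneg[of a'] b_nonneg[of a']
      by (intro frac_le add_left_mono power_mono b_antimono add_pos_nonneg) auto
    show "P (k * K a * a) - Q (k * K a * a) \<le> P (k * K a' * a') - Q (k * K a' * a')"
      by (rule P_minus_Q_mono[OF u])
    show "0 \<le> (1 + kappa a') / (1 + b a' ^ (d - 1))"
      using kappa_nonneg[of a'] b_nonneg[of a'] assms lt by simp
    show "0 \<le> P (k * K a * a) - Q (k * K a * a)" using Q_le_P[of "k * K a * a"] u by simp
  qed
  then show ?thesis using assms lt by (simp add: G1_eq)
qed

lemma G2_antimono:
  assumes "0 \<le> a" "a \<le> a'" "a' < aI d"
  shows "G2 d a' \<le> G2 d a"
  unfolding G2_def using assms k_pos j_less_w[of a'] w_le_k[of a]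
  by (intro mult_left_mono gnu_mono w_antimono) auto

lemma G2_neg: "0 \<le> a \<Longrightarrow> a < aI d \<Longrightarrow> G2 d a < 0"
  unfolding G2_def using k_pos gnu_neg[OF j_less_w w_le_k, of a] by (simp add: mult_pos_neg)

text \<open>Dividing \<open>Fnu\<close> by \<open>K\<^sup>d\<close> makes the leading terms of the derivative cancel:
  \<open>H = Fnu / K\<^sup>d\<close> satisfies \<open>H' \<le> k a\<^bsup>d-1\<^esup> (- G2) H\<close> as long as \<open>G1 + G2 \<le> 0\<close>.
  At \<open>a = 0\<close>, where \<open>K\<close> vanishes, \<open>H\<close> is extended continuously through \<open>fnu_quot\<close>.\<close>

lemma Fnu_nonpos_first:
  assumes G: "G1 d x1 + G2 d 0 \<le> 0" and a: "0 < a" "a \<le> x1" "a < aI d" and x1: "x1 \<le> aI d"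
  shows "Fnu d k a \<le> 0"
proof -
  define H where "H t = (k * t) ^ d * fnu_quot (k * K t * t) + fnu d (k * b t)" for t
  define \<phi> where "\<phi> t = fnu d (k * K t * t) / K t ^ d" for t
  define Su where "Su t = (P (k * K t * t))\<^sup>2 - (Q (k * K t * t))\<^sup>2" for t
  define Sw where "Sw t = (P (k * b t))\<^sup>2 - (Q (k * b t))\<^sup>2" for t
  define H' where "H' t = k ^ d * t ^ (d - 1) * (1 + kappa t) * (2 + Su t)
      - real d * kappa t / t * \<phi> t + - (k ^ d * t ^ (d - 1) * (2 + Sw t))" for t
  have u: "0 \<le> k * K t * t" "k * K t * t < j" if "0 \<le> t" "t \<le> a" for t
    using that a x1 u_less_j[of t] k_pos K_nonneg[of t] aI_less_1 by auto
  have Ju: "J0 (k * K t * t) \<noteq> 0" if "0 \<le> t" "t \<le> a" for t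
    using J0_pos[OF u[OF that]] by simp
  have w: "j < k * b t" "k * b t \<le> k" if "0 \<le> t" "t \<le> a" for t
    using that a j_less_w[of t] w_le_k[of t] by auto
  have Jw: "J0 (k * b t) \<noteq> 0" if "0 \<le> t" "t \<le> a" for t
    using J0_neg_k[OF w[OF that]] by simp
  have H_eq: "H t = \<phi> t + fnu d (k * b t)" if "0 < t" "t \<le> a" for t
  proof -
    have "0 < K t" using K_pos[of t] that a aI_less_1 by simp
    then show ?thesis
      using u[of t] that by (simp add: H_def \<phi>_def fnu_eq_quot power_mult_distrib)
  qed
  have "0 \<le> - H a"
  \<comment> \<open>On [0, a] the quantity -G2 is largest at a, which gives a constant growth rate
    for \<open>H\<close>.\<close>
  proof (rule nonneg_if_deriv_ge_linear[where a = 0 and b = a and M = "- (k * G2 d a)"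
        and w = "\<lambda>t. - H t" and w' = "\<lambda>t. - H' t"])
    show "0 \<le> a" using a by simp
    \<comment> \<open>The start value is f(k) = 0, because b(0) = 1.\<close>
    show "0 \<le> - H 0" using fnu_k d_ge_4 by (simp add: H_def power_0_left)
    have cu: "continuous_on {0..a} (\<lambda>t. k * K t * t)"
      using a aI_less_1 by (intro continuous_intros) auto
    have "continuous_on {0..a} (\<lambda>t. fnu_quot (k * K t * t))"
      by (rule continuous_on_compose2[OF continuous_on_fnu_quot cu,
            where t = "(\<lambda>t. k * K t * t) ` {0..a}"]) (use Ju in auto)
    moreover have "continuous_on {0..a} (\<lambda>t. fnu d (k * b t))"
      by (rule continuous_on_compose2[OF continuous_on_fnu,
            where t = "(\<lambda>t. k * b t) ` {0..a}"])
        (use Jw w(1) j_pos in \<open>force intro!: continuous_intros\<close>)+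
    ultimately show "continuous_on {0..a} (\<lambda>t. - H t)"
      unfolding H_def[abs_def] by (intro continuous_intros)
    fix t assume t: "0 < t" "t < a"
    have t1: "t < 1" "t < aI d" using t a aI_less_1 by auto
    have K0: "0 < K t" using K_pos[of t] t t1 by simp
    have kap: "0 \<le> kappa t" using kappa_nonneg t t1 by simp
    have "((\<lambda>t. fnu d (k * K t * t) / K t ^ d) has_real_derivative
        k ^ d * t ^ (d - 1) * (1 + kappa t) * (2 + Su t) - real d * kappa t / t * \<phi> t) (at t)"
    proof -
      have Kd: "((\<lambda>t. K t ^ d) has_real_derivative K t ^ d * (real d * kappa t / t)) (at t)"
        using DERIV_power[OF DERIV_K[of t], of d] t t1
        by (simp add: power_d[of "K t"] mult_ac)
      have fu: "((\<lambda>t. fnu d (k * K t * t)) has_real_derivative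
          k ^ d * t ^ (d - 1) * K t ^ d * (1 + kappa t) * (2 + Su t)) (at t)"
        using DERIV_fnu_u[of t] Ju[of t] t t1 by (simp add: Su_def add_diff_eq)
      have "((\<lambda>t. fnu d (k * K t * t) / K t ^ d) has_real_derivative
          (k ^ d * t ^ (d - 1) * K t ^ d * (1 + kappa t) * (2 + Su t) * K t ^ d
            - fnu d (k * K t * t) * (K t ^ d * (real d * kappa t / t))) / (K t ^ d * K t ^ d)) (at t)"
        using K0 by (intro DERIV_divide fu Kd) auto
      moreover have "(A * L * B * C * L - f * (L * D)) / (L * L) = A * B * C - D * (f / L)"
        if "L \<noteq> 0" for A B C D L f :: real using that by (simp add: field_simps)
      moreover have "K t ^ d \<noteq> 0" using K0 by simp
      ultimately show ?thesis by (simp only: \<phi>_def not_False_eq_True)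
    qed
    moreover have "((\<lambda>t. fnu d (k * b t)) has_real_derivative
        - (k ^ d * t ^ (d - 1) * (2 + Sw t))) (at t)"
      using DERIV_fnu_w[of t] Jw[of t] t t1 by (simp add: Sw_def add_diff_eq)
    ultimately have "((\<lambda>t. fnu d (k * K t * t) / K t ^ d + fnu d (k * b t)) has_real_derivative
        H' t) (at t)"
      unfolding H'_def by (rule DERIV_add)
    then have "(H has_real_derivative H' t) (at t)"
      by (rule has_field_derivative_transform_within_open[where S = "{0<..<a}"])
        (use t H_eq in \<open>auto simp: \<phi>_def\<close>)
    then show "((\<lambda>t. - H t) has_real_derivative - H' t) (at t)" by (rule DERIV_minus)
    assume "- H t < 0"
    then have Hpos: "0 < H t" by simp
    have \<phi>0: "2 * (k * t) ^ d / real d \<le> \<phi> t"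
    proof -
      have "2 * (k * K t * t) ^ d / real d / K t ^ d \<le> \<phi> t"
        unfolding \<phi>_def using fnu_ge[OF u, of t] t K0 by (intro divide_right_mono) auto
      then show ?thesis using K0 by (simp add: power_mult_distrib)
    qed
    have \<phi>nn: "0 \<le> \<phi> t" unfolding \<phi>_def using fnu_nonneg[OF u, of t] t K0 by simp
    \<comment> \<open>The term from differentiating 1 / K^d absorbs the contribution 2 kappa of f',
      which is unbounded relative to the rest in no controlled way otherwise.\<close>
    have "2 * kappa t * k ^ d * t ^ (d - 1) \<le> real d * kappa t / t * \<phi> t"
    proof -
      have "real d * kappa t / t * (2 * (k * t) ^ d / real d) \<le> real d * kappa t / t * \<phi> t"
        using \<phi>0 kap t by (intro mult_left_mono) auto
      moreover have "real d * kappa t / t * (2 * (k * t) ^ d / real d) = 2 * kappa t * k ^ d * t ^ (d - 1)"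
        using t real_d_ge_4 by (simp add: power_mult_distrib power_d[of t])
      ultimately show ?thesis by simp
    qed
    then have "H' t \<le> k ^ d * t ^ (d - 1) * ((1 + kappa t) * Su t - Sw t)"
      unfolding H'_def by (simp add: algebra_simps)
    \<comment> \<open>Both differences of squares are rewritten as f g, turning the bound into an
      expression in G1 and G2.\<close>
    also have "\<dots> = k * t ^ (d - 1) * (\<phi> t * G1 d t - fnu d (k * b t) * G2 d t)"
    proof -
      have "0 < k * K t * t" using t K0 k_pos by simp
      then have Su: "Su t = fnu d (k * K t * t) * gnu d (k * K t * t)"
        by (simp add: fnu_times_gnu Su_def)
      have "0 < k * b t" using w[of t] t j_pos by simp
      then have Sw: "Sw t = fnu d (k * b t) * gnu d (k * b t)"
        by (simp add: fnu_times_gnu Sw_def)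
      have "t * Kder d t + K t = K t * (1 + kappa t)"
        using t t1 by (simp add: Kder_eq algebra_simps)
      then have "\<phi> t * G1 d t = \<phi> t * (K t * (1 + kappa t) * (k * K t) ^ (d - 1) * gnu d (k * K t * t))"
        by (simp add: G1_def mult_ac)
      also have "\<dots> = \<phi> t * K t ^ d * (k ^ (d - 1) * (1 + kappa t) * gnu d (k * K t * t))"
        by (simp add: power_mult_distrib power_d[of "K t"] mult_ac)
      also have "\<phi> t * K t ^ d = fnu d (k * K t * t)" using K0 by (simp add: \<phi>_def)
      finally have "\<phi> t * G1 d t = k ^ (d - 1) * ((1 + kappa t) * Su t)" by (simp add: Su mult_ac)
      moreover have "fnu d (k * b t) * G2 d t = k ^ (d - 1) * Sw t"
        by (simp add: G2_def Sw mult_ac)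
      ultimately show ?thesis by (simp add: power_d[of k] right_diff_distrib mult_ac)
    qed
    also have "\<dots> \<le> k * t ^ (d - 1) * (- G2 d t * H t)"
    proof (rule mult_left_mono)
      have "G1 d t + G2 d t \<le> 0"
        using G1_mono[of t x1] G2_antimono[of 0 t] t t1 a x1 G by simp
      then have "\<phi> t * (G1 d t + G2 d t) \<le> 0" using \<phi>nn by (rule mult_nonneg_nonpos[rotated])
      then show "\<phi> t * G1 d t - fnu d (k * b t) * G2 d t \<le> - G2 d t * H t"
        using H_eq[of t] t by (simp add: algebra_simps)
    qed (use k_pos t in simp)
    also have "\<dots> \<le> k * 1 * (- G2 d a * H t)"
      using G2_neg[of t] G2_antimono[of t a] t t1 a k_pos Hpos
      by (intro mult_mono mult_right_mono mult_left_mono) (auto simp: power_le_one mult_nonpos_nonneg)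
    finally show "- (k * G2 d a) * - H t \<le> - H' t" by (simp add: algebra_simps)
  qed
  then have "K a ^ d * H a \<le> 0" using K_nonneg[of a] a aI_less_1 by (intro mult_nonneg_nonpos) auto
  moreover have "K a ^ d * H a = Fnu d k a"
    using H_eq[of a] K_pos[of a] a aI_less_1 by (simp add: Fnu_def \<phi>_def distrib_left)
  ultimately show ?thesis by simp
qed

section \<open>The last interval, ending at a = 1\<close>

lemma Fnu_1: "Fnu d k 1 = 0"
  by (simp add: Fnu_def fnu_k)

text \<open>After cancellation F' consists of two nonnegative terms and a multiple of 2 kappa - (P^2
  - Q^2)(k b). The hypothesis at c propagates to the right since kappa increases and P^2 - Q^2
  decreases along k b.\<close>

lemma Fnu_nonpos_last:
  assumes c: "aS d \<le> c" "c < 1" and S: "(P (k * b c))\<^sup>2 - (Q (k * b c))\<^sup>2 \<le> 2 * kappa c"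
    and a: "c \<le> a" "aS d < a" "a < 1"
  shows "Fnu d k a \<le> 0"
proof -
  have u: "j < k * K t * t" "k * K t * t \<le> k" if "a \<le> t" "t \<le> 1" for t
    using that a j_less_u[of t] u_le_k[of t] aS_pos by auto
  have w: "0 \<le> k * b t" "k * b t < j" if "a \<le> t" "t \<le> 1" for t
    using that a w_less_j[of t] aS_pos k_pos b_nonneg[of t] by auto
  have Ju: "J0 (k * K t * t) \<noteq> 0" if "a \<le> t" "t \<le> 1" for t
    using J0_neg_k[OF u[OF that]] by simp
  have Jw: "J0 (k * b t) \<noteq> 0" if "a \<le> t" "t \<le> 1" for t
    using J0_pos[OF w[OF that]] by simp
  have "Fnu d k a \<le> Fnu d k 1"
  proof (rule DERIV_nonneg_imp_increasing_open[of a 1 "Fnu d k"])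
    have cu: "continuous_on {a..1} (\<lambda>t. k * K t * t)" and cK: "continuous_on {a..1} K"
      using a aS_pos by (intro continuous_intros; force)+
    have "continuous_on {a..1} (\<lambda>t. fnu d (k * K t * t))"
      by (rule continuous_on_compose2[OF continuous_on_fnu cu,
            where t = "(\<lambda>t. k * K t * t) ` {a..1}"]) (use Ju u(1) j_pos in force)+
    moreover have "continuous_on {a..1} (\<lambda>t. fnu d (k * b t))"
      by (rule continuous_on_compose2[OF continuous_on_fnu,
            where t = "(\<lambda>t. k * b t) ` {a..1}"])
        (use Jw w(1) in \<open>force intro!: continuous_intros\<close>)+
    ultimately show "continuous_on {a..1} (Fnu d k)"
      unfolding Fnu_def[abs_def] by (intro continuous_on_add continuous_on_mult continuous_on_power cK)
    fix t assume t: "a < t" "t < 1"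
    have t0: "0 < t" using t a aS_pos by simp
    have K0: "0 < K t" using K_pos t0 t by simp
    define Su where "Su = (P (k * K t * t))\<^sup>2 - (Q (k * K t * t))\<^sup>2"
    define Sw where "Sw = (P (k * b t))\<^sup>2 - (Q (k * b t))\<^sup>2"
    define E where "E = k ^ d * t ^ (d - 1) * K t ^ d"
    have E: "0 \<le> E" using k_pos t0 K0 by (simp add: E_def)
    have Kd: "((\<lambda>t. K t ^ d) has_real_derivative K t ^ d * (real d * kappa t / t)) (at t)"
      using DERIV_power[OF DERIV_K[of t], of d] t t0
      by (simp add: power_d[of "K t"] mult_ac)
    have fu: "((\<lambda>t. fnu d (k * K t * t)) has_real_derivative E * (1 + kappa t) * (2 + Su)) (at t)"
      using DERIV_fnu_u[of t] Ju[of t] t t0 by (simp add: Su_def E_def add_diff_eq)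
    have fw: "((\<lambda>t. fnu d (k * b t)) has_real_derivative - (k ^ d * t ^ (d - 1) * (2 + Sw))) (at t)"
      using DERIV_fnu_w[of t] Jw[of t] t t0 by (simp add: Sw_def add_diff_eq)
    have "(Fnu d k has_real_derivative E * (1 + kappa t) * (2 + Su)
        + (K t ^ d * (real d * kappa t / t) * fnu d (k * b t)
          + - (k ^ d * t ^ (d - 1) * (2 + Sw)) * K t ^ d)) (at t)"
      unfolding Fnu_def[abs_def] by (intro DERIV_add DERIV_mult fu fw Kd)
    moreover have "0 \<le> E * (1 + kappa t) * (2 + Su)
        + (K t ^ d * (real d * kappa t / t) * fnu d (k * b t)
          + - (k ^ d * t ^ (d - 1) * (2 + Sw)) * K t ^ d)"
    proof -
      have kap: "0 \<le> kappa t" using kappa_nonneg t0 t by simp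
      have "0 \<le> Su" using Q2_le_P2[OF u, of t] t by (simp add: Su_def)
      then have 1: "0 \<le> E * ((1 + kappa t) * Su)" using E kap by simp
      have 2: "0 \<le> K t ^ d * (real d * kappa t / t) * fnu d (k * b t)"
        using K0 kap t0 fnu_nonneg[OF w, of t] t by simp
      have "0 < k * b t" using b_pos[of t] t0 t k_pos by simp
      then have "Sw \<le> (P (k * b c))\<^sup>2 - (Q (k * b c))\<^sup>2"
        unfolding Sw_def using w_less_j[of c] w_antimono[of c t] c a t aS_pos
        by (intro P2_minus_Q2_mono) auto
      also have "\<dots> \<le> 2 * kappa t" using S kappa_mono[of c t] c a t aS_pos by simp
      finally have 3: "0 \<le> E * (2 * kappa t - Sw)" using E by simp
      have "E * (1 + kappa t) * (2 + Su) + (X + - (k ^ d * t ^ (d - 1) * (2 + Sw)) * K t ^ d)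
          = E * ((1 + kappa t) * Su) + X + E * (2 * kappa t - Sw)" for X
        by (simp add: E_def algebra_simps)
      then show ?thesis using 1 2 3 by simp
    qed
    ultimately show "\<exists>y. (Fnu d k has_real_derivative y) (at t) \<and> 0 \<le> y" by blast
  qed (use a in simp)
  then show ?thesis by (simp add: Fnu_1)
qed

text \<open>T1 is kappa times a^(d-1) K^d, a factor of at most 1.\<close>

lemma T1_le_kappa:
  assumes "0 < a" "a < 1"
  shows "T1 d a \<le> kappa a"
proof -
  have K0: "0 < K a" "K a \<le> 1" using K_pos K_le_1 assms by auto
  have "T1 d a = a ^ (d - 1) * K a ^ d * kappa a"
    using assms K0 by (simp add: T1_def Kder_eq power_mult_distrib power_d[of a])
  also have "\<dots> \<le> 1 * kappa a"
    using assms K0 kappa_nonneg[of a] by (intro mult_right_mono mult_le_one power_le_one) auto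
  finally show ?thesis by simp
qed

end

section \<open>Subdivisions and the assembly of the cases\<close>

lemma seq_mono:
  fixes x :: "nat \<Rightarrow> real"
  assumes "\<And>i. i \<le> n \<Longrightarrow> x i < x (i + 1)" "i \<le> l" "l \<le> n + 1"
  shows "x i \<le> x l"
  using assms(2,3)
proof (induction l)
  case (Suc l)
  then show ?case using assms(1)[of l] by (cases "i = Suc l") auto
qed simp

lemma exists_partition_interval:
  fixes x :: "nat \<Rightarrow> real"
  assumes "x 0 \<le> a" "a < x (n + 1)"
  shows "\<exists>i\<le>n. x i \<le> a \<and> a < x (i + 1)"
  using assms(2)
proof (induction n)
  case 0
  then show ?case using assms(1) by simp
next
  case (Suc n)
  show ?case
  proof (cases "a < x (n + 1)")
    case True
    then show ?thesis using Suc.IH le_SucI by blast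
  next
    case False
    then show ?thesis using Suc.prems by (intro exI[of _ "Suc n"]) simp
  qed
qed

theorem theorem6:
  fixes d n m :: nat and x y :: "nat \<Rightarrow> real"
  assumes hd: "d \<ge> 4"
    and hx0: "x 0 = 0" and hxn: "x (n+1) = aI d"
    and hxmono: "\<And>i. i \<le> n \<Longrightarrow> x i < x (i+1)"
    and hx: "\<And>i. 1 \<le> i \<Longrightarrow> i \<le> n \<Longrightarrow>
        fnu d (kzero d * Kfun d (x (i+1)) * x (i+1)) + (Kfun d (x i))^d * fnu d (kzero d * bfun d (x i)) \<le> 0"
    and hG: "G1 d (x 1) + G2 d (x 0) \<le> 0"
    and hy0: "y 0 = aS d" and hym: "y (m+1) = 1"
    and hymono: "\<And>i. i \<le> m \<Longrightarrow> y i < y (i+1)"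
    and hy: "\<And>i. i < m \<Longrightarrow>
        fnu d (kzero d * Kfun d (y (i+1)) * y (i+1)) + fnu d (kzero d * bfun d (y i)) \<le> 0"
    and hT: "2 * T1 d (y m) - fnu d (kzero d * bfun d (y m)) * \<bar>gnu d (kzero d * Kfun d (y m) * y m)\<bar>
               * ((real d - 1) / (y m)^d * (1 + 1 / bfun d (y m)) + 1)
             - fnu d (kzero d * bfun d (y m)) * gnu d (kzero d * bfun d (y m)) \<ge> 0"
  shows "\<forall>a. (0 \<le> a \<and> a < aI d) \<or> (aS d < a \<and> a \<le> 1) \<longrightarrow> Fnu d (kzero d) a \<le> 0"
proof (intro allI impI)
  interpret bessel_dim d by unfold_locales (fact hd)
  fix a assume "(0 \<le> a \<and> a < aI d) \<or> (aS d < a \<and> a \<le> 1)"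
  then show "Fnu d k a \<le> 0"
  proof
    assume a: "0 \<le> a \<and> a < aI d"
    then obtain i where i: "i \<le> n" "x i \<le> a" "a < x (i + 1)"
      using exists_partition_interval[of x a n] hx0 hxn by auto
    have xI: "x (i + 1) \<le> aI d" using seq_mono[of n x "i + 1" "n + 1"] hxmono hxn i by simp
    show ?thesis
    \<comment> \<open>The first interval needs the differential argument, which assumes a > 0; at a
      = 0 the function F vanishes.\<close>
    proof (cases "i = 0 \<or> a = 0")
      case True
      show ?thesis
      proof (cases "a = 0")
        case True
        then show ?thesis using d_ge_4 by (simp add: Fnu_def power_0_left)
      next
        case False
        then show ?thesis
          using Fnu_nonpos_first[of "x 1" a] \<open>i = 0 \<or> a = 0\<close> i a xI hG hx0 by simp
      qed
    next
      case False
      then have i1: "1 \<le> i" by simp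
      have x0: "0 \<le> x i" using seq_mono[of n x 0 i] hxmono hx0 i by simp
      have "fnu d (k * K a * a) \<le> fnu d (k * K (x (i + 1)) * x (i + 1))"
        using a i xI aI_less_1 k_pos K_nonneg[of a]
        by (intro fnu_mono_below_j u_mono u_less_j) auto
      \<comment> \<open>Here f(k b(a)) <= 0, so passing to the smaller K(x_i) increases the
        product.\<close>
      moreover have "K a ^ d * fnu d (k * b a) \<le> K (x i) ^ d * fnu d (k * b a)"
        using a i x0 aI_less_1 fnu_nonpos[OF j_less_w w_le_k, of a]
        by (intro mult_right_mono_neg power_mono K_mono K_nonneg) auto
      moreover have "K (x i) ^ d * fnu d (k * b a) \<le> K (x i) ^ d * fnu d (k * b (x i))"
        using a i x0 aI_less_1 K_nonneg[of "x i"]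
        by (intro mult_left_mono fnu_mono_above_j j_less_w w_antimono w_le_k) auto
      ultimately show ?thesis using hx[OF i1 i(1)] by (simp add: Fnu_def)
    qed
  next
    assume a: "aS d < a \<and> a \<le> 1"
    show ?thesis
    proof (cases "a = 1")
      case True
      then show ?thesis by (simp add: Fnu_1)
    next
      case False
      then obtain i where i: "i \<le> m" "y i \<le> a" "a < y (i + 1)"
        using exists_partition_interval[of y a m] hy0 hym a by auto
      have yS: "aS d \<le> y i" using seq_mono[of m y 0 i] hymono hy0 i by simp
      show ?thesis
      proof (cases "i = m")
        case True
        have ym: "aS d \<le> y m" "y m < 1" using yS True hymono[of m] hym by auto
        have ym0: "0 < y m" using ym aS_pos by simp
        have b0: "0 < b (y m)" using b_pos[of "y m"] ym ym0 by simp
        have "0 \<le> fnu d (k * b (y m))" using fnu_nonneg w_less_j[of "y m"] ym b0 k_pos by simp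
        moreover have "0 \<le> (real d - 1) / (y m) ^ d * (1 + 1 / b (y m)) + 1"
          using ym0 b0 real_d_ge_4 by (intro add_nonneg_nonneg mult_nonneg_nonneg) auto
        ultimately have "0 \<le> fnu d (k * b (y m)) * \<bar>gnu d (k * K (y m) * y m)\<bar>
            * ((real d - 1) / (y m) ^ d * (1 + 1 / b (y m)) + 1)"
          by (intro mult_nonneg_nonneg) auto
        text \<open>For \<open>m = 0\<close> the value \<open>gnu d (k * K (y m) * y m)\<close> is junk, since \<open>P\<close> has a pole at
          \<open>k * K (aS d) * aS d = j\<close>; only the sign of its absolute value matters.\<close>
        then have "fnu d (k * b (y m)) * gnu d (k * b (y m)) \<le> 2 * T1 d (y m)"
          using hT by linarith
        also have "\<dots> \<le> 2 * kappa (y m)" using T1_le_kappa[of "y m"] ym ym0 by simp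
        finally have "(P (k * b (y m)))\<^sup>2 - (Q (k * b (y m)))\<^sup>2 \<le> 2 * kappa (y m)"
          using fnu_times_gnu[of "k * b (y m)"] b0 k_pos by simp
        then show ?thesis using Fnu_nonpos_last[of "y m" a] ym a i True False by simp
      next
        case False
        then have im: "i < m" using i by simp
        have y1: "y (i + 1) \<le> 1" using seq_mono[of m y "i + 1" "m + 1"] hymono hym i by simp
        have y0: "0 < y i" using yS aS_pos by simp
        have "fnu d (k * K a * a) \<le> fnu d (k * K (y (i + 1)) * y (i + 1))"
          using a i y1 y0 by (intro fnu_mono_above_j u_mono j_less_u u_le_k) auto
        \<comment> \<open>Here f(k b(a)) >= 0, so K^d is bounded by 1; this is why \<open>hy\<close>
          carries no factor K^d.\<close>
        moreover have "K a ^ d * fnu d (k * b a) \<le> 1 * fnu d (k * b a)"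
          using a i y0 yS K_nonneg[of a] K_le_1[of a] k_pos b_nonneg[of a] w_less_j[of a]
          by (intro mult_right_mono power_le_one fnu_nonneg) auto
        moreover have "fnu d (k * b a) \<le> fnu d (k * b (y i))"
          using a i y0 yS k_pos b_nonneg[of a]
          by (intro fnu_mono_below_j w_antimono w_less_j) auto
        ultimately show ?thesis using hy[OF im] by (simp add: Fnu_def)
      qed
    qed
  qed
qed

end
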